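(* Let $n\ge1$, $p>-n$ and $\mathbf z,\mathbf w\in\mathbb C^n$. Assume $\mathbf z\cdot\mathbf w\ne0$ and $|\mathrm{Arg}(\mathbf z\cdot\mathbf w)|<\pi$. Then, as $\hbar\to0$, $$\langle\mathbf K^\hbar_{n,p}(\cdot,\mathbf w),\mathbf K^\hbar_{n,p}(\cdot,\mathbf z)\rangle_{\mathbf S^n}=\mathbf T_{n,p}(\mathbf z,\mathbf w)=\frac{\Gamma(n+p)}{2\sqrt\pi}\left(\frac{\mathbf z\cdot\mathbf w}{\hbar^2}\right)^{\frac12(-p-n+\frac12)}e^{\frac2\hbar\sqrt{\mathbf z\cdot\mathbf w}}\left[1-\frac{(n+p-\frac32)(n+p-\frac12)}{4\sqrt{\mathbf z\cdot\mathbf w}}\hbar+\mathrm O(\hbar^2)\right].$$ In particular, for $\mathbf z\in\mathbb C^n\setminus\{\mathbf 0\}$, $$\|\mathbf K^\hbar_{n,p}(\cdot,\mathbf z)\|^2_{\mathbf S^n}=\frac{\Gamma(n+p)}{2\sqrt\pi}\left(\frac{|\mathbf z|}{\hbar}\right)^{-p-n+\frac12}e^{\frac2\hbar|\mathbf z|}\left[1-\frac{(n+p-\frac32)(n+p-\frac12)}{4|\mathbf z|}\hbar+\mathrm O(\hbar^2)\right].$$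
   Context: For $\mathbf a,\mathbf b\in\mathbb C^n$, $\mathbf a\cdot\mathbf b=\sum_{j=1}^n a_j\overline{b_j}$, $|\mathbf a|=\sqrt{\mathbf a\cdot\mathbf a}$. $\mathbf S^n=\{\mathbf x\in\mathbb C^n:|\mathbf x|=1\}$ with normalized surface measure $\mathrm d\mathbf S_n$; $\langle\phi,\psi\rangle_{\mathbf S^n}=\int_{\mathbf S^n}\phi\overline\psi\,\mathrm d\mathbf S_n$, with norm $\|\cdot\|_{\mathbf S^n}$. For $\hbar>0$, $p>-n$, $\mathbf x\in\mathbf S^n$, $\mathbf z\in\mathbb C^n$: $\mathbf K^\hbar_{n,p}(\mathbf x,\mathbf z)=\sum_{\ell=0}^\infty\frac{c_{\ell,p}}{\ell!}\left(\frac{\mathbf x\cdot\mathbf z}{\hbar}\right)^\ell$, where $c_{\ell,p}>0$, $(c_{\ell,p})^2=\frac{(n)_\ell}{(n+p)_\ell}$ and $(a)_\ell=a(a+1)\cdots(a+\ell-1)$. The function $\mathbf T_{n,p}$ is $\mathbf T_{n,p}(\mathbf z,\mathbf w)=\Gamma(n+p)\left(\frac{\mathbf z\cdot\mathbf w}{\hbar^2}\right)^{\frac12(-p-n+1)}\mathrm I_{n+p-1}\!\left(\frac{2\sqrt{\mathbf z\cdot\mathbf w}}{\hbar}\right)$, where $\mathrm I_\nu$ is the modified Bessel function of the first kind of order $\nu$. Square roots and powers use the principal branch ($|\mathrm{Arg}|<\pi$). *)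

theory Defs
  imports "HOL-Analysis.Analysis" "HOL-Library.Landau_Symbols"
begin

definition hdot :: "complex ^ 'n \<Rightarrow> complex ^ 'n::finite \<Rightarrow> complex" where
  "hdot a b = (\<Sum>j\<in>UNIV. a $ j * cnj (b $ j))"

(* The normalized surface measure of the unit sphere, given by the cone formula:
   the measure of a Borel set A of the sphere is vol {r x | 0 < r < 1, x \<in> A} / vol (ball 0 1),
   that is, the image of the uniform distribution on the unit ball under
   sgn x = x / |x|.  (The point 0, where sgn 0 = 0, is a null set.) *)
definition sphere_measure :: "'a::euclidean_space measure" where
  "sphere_measure =
     restrict_space (distr (uniform_measure lborel (ball 0 1)) borel sgn) (sphere 0 1)"

definition sphere_inner ::
    "(complex ^ 'n \<Rightarrow> complex) \<Rightarrow> (complex ^ 'n::finite \<Rightarrow> complex) \<Rightarrow> complex" where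
  "sphere_inner \<phi> \<psi> = (LINT x|sphere_measure. \<phi> x * cnj (\<psi> x))"

definition sphere_norm :: "(complex ^ 'n::finite \<Rightarrow> complex) \<Rightarrow> real" where
  "sphere_norm \<phi> = sqrt (Re (sphere_inner \<phi> \<phi>))"

definition kernel_coeff :: "nat \<Rightarrow> real \<Rightarrow> nat \<Rightarrow> real" where
  "kernel_coeff n p l = sqrt (pochhammer (real n) l / pochhammer (real n + p) l)"

definition K_kernel :: "real \<Rightarrow> real \<Rightarrow> complex ^ 'n \<Rightarrow> complex ^ 'n::finite \<Rightarrow> complex" where
  "K_kernel h p x z =
     (\<Sum>l. complex_of_real (kernel_coeff CARD('n) p l / fact l) * (hdot x z / complex_of_real h) ^ l)"

(* Modified Bessel function of the first kind, principal branch.  Since 0 powr a = 0,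
   the value at y = 0 is always 0 (also for nu = 0, where the limit is 1). *)
definition bessel_I :: "complex \<Rightarrow> complex \<Rightarrow> complex" where
  "bessel_I \<nu> y = (y / 2) powr \<nu> * (\<Sum>k. rGamma (\<nu> + of_nat k + 1) / fact k * (y / 2) ^ (2 * k))"

definition T_fun :: "real \<Rightarrow> real \<Rightarrow> complex ^ 'n \<Rightarrow> complex ^ 'n::finite \<Rightarrow> complex" where
  "T_fun h p z w =
     complex_of_real (Gamma (real CARD('n) + p))
     * (hdot z w / complex_of_real h ^ 2) powr complex_of_real (1/2 * (- p - real CARD('n) + 1))
     * bessel_I (complex_of_real (real CARD('n) + p - 1)) (2 * csqrt (hdot z w) / complex_of_real h)"

end

theory Submission
  imports Defs "HOL-Probability.Distributions" "HOL-Complex_Analysis.Cauchy_Integral_Formula" "HOL-Real_Asymp.Real_Asymp"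
begin

text \<open>
  Both sides equal \<open>0F1(n+p; (z \<cdot> w)/h\<^sup>2)\<close>. For the inner product one needs the moments
  \<open>(x \<cdot> w)\<^sup>l (z \<cdot> x)\<^sup>m\<close> on the sphere. By polar coordinates they are quotients of Gaussian moments,
  and those are the Taylor coefficients in \<open>s, t\<close> of
  \<open>\<integral> exp (s (x \<cdot> w) + t (z \<cdot> x) - |x|\<^sup>2) dx = \<pi>\<^sup>n exp (s t (z \<cdot> w))\<close>, a product of one-dimensional integrals.

  For the asymptotics with \<open>v = sqrt (z \<cdot> w) / h\<close> and \<open>a = n + p > 3/2\<close>, Poisson's integral expresses \<open>0F1(a; v\<^sup>2)\<close>
  as \<open>exp (2v)\<close> times a Laplace integral of \<open>(x (1-x))\<close> to the power \<open>a - 3/2\<close> over \<open>[0,1]\<close>, to which Watson's lemma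
  with two terms applies. The contiguous relation between \<open>0F1\<close> at \<open>a\<close>, \<open>a+1\<close> and \<open>a+2\<close> carries
  the expansion down to all \<open>a > 0\<close>.
\<close>

section \<open>Preliminaries on integrals and power series\<close>

text \<open>Moments are read off the Gaussian generating function one variable at a time: the
  exponential series is integrated termwise under a fixed majorant, and coefficients are compared on
  an interval of positive reals. No differentiation under the integral sign is involved. The same
  scheme gives the moments of \<open>norm x\<close>, so the radial integrals are never reduced to
  one dimension.

  In the asymptotics the obstacle is a complex \<open>v\<close>: the Laplace remainder is controlled
  by \<open>Re v\<close>, the required error by \<open>norm v\<close>, and these are comparable only
  in a sector \<open>d * norm v \<le> Re v\<close>. As \<open>h\<close> tends to 0, \<open>v\<close>
  moves along a fixed ray, and the condition on \<open>Arg\<close> puts this ray into the open right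
  half-plane. For \<open>a > 3/2\<close> the Poisson weight is continuous up to both endpoints, so
  the endpoint \<open>x = 1\<close> does not disturb the expansion at 0. The correction is
  \<open>m * c / w\<close> with \<open>m = a - 3/2\<close>, \<open>c = a - 1/2\<close>,
  \<open>w = 4 * v\<close>: \<open>- m\<close> is the slope of \<open>(1 - x) powr m\<close> at 0,
  \<open>c\<close> a quotient of Gamma values, \<open>w\<close> the Laplace rate.\<close>

lemma
  fixes f :: "nat \<Rightarrow> 'a \<Rightarrow> 'b::{banach, second_countable_topology}"
  assumes meas: "\<And>i. f i \<in> borel_measurable M" and w: "integrable M w"
    and sums: "\<And>x. x \<in> space M \<Longrightarrow> (\<lambda>i. f i x) sums g x"
    and bound: "\<And>x N. x \<in> space M \<Longrightarrow> (\<Sum>i<N. norm (f i x)) \<le> w x"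
  shows integrable_sums_dominated: "integrable M g"
    and integral_sums_dominated: "(\<lambda>i. integral\<^sup>L M (f i)) sums integral\<^sup>L M g"
    and integrable_sums_dominated_term: "integrable M (f i)"
proof -
  have int: "integrable M (f i)" for i
  proof (rule Bochner_Integration.integrable_bound[OF w meas])
    have "norm (f i x) \<le> w x" if "x \<in> space M" for x
    proof -
      have "norm (f i x) \<le> (\<Sum>j<Suc i. norm (f j x))"
        by (rule member_le_sum) auto
      then show ?thesis using bound[OF that, of "Suc i"] by linarith
    qed
    then show "AE x in M. norm (f i x) \<le> norm (w x)" by (intro AE_I2) (metis abs_ge_self order_trans real_norm_def)
  qed
  have g: "g \<in> borel_measurable M"
    by (rule borel_measurable_LIMSEQ_metric[where f="\<lambda>N x. \<Sum>i<N. f i x"])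
       (use meas sums in \<open>auto simp: sums_def\<close>)
  have b: "norm (\<Sum>i<N. f i x) \<le> w x" if "x \<in> space M" for N x
    by (rule order_trans[OF norm_sum bound[OF that]])
  show "integrable M (f i)" by (rule int)
  show "integrable M g"
    by (rule integrable_dominated_convergence[where s="\<lambda>N x. \<Sum>i<N. f i x" and w=w])
       (use g meas w sums b in \<open>auto simp: sums_def\<close>)
  have "(\<lambda>N. \<integral>x. (\<Sum>i<N. f i x) \<partial>M) \<longlonglongrightarrow> integral\<^sup>L M g"
    by (rule integral_dominated_convergence[where w=w])
       (use g meas w sums b in \<open>auto simp: sums_def\<close>)
  then show "(\<lambda>i. integral\<^sup>L M (f i)) sums integral\<^sup>L M g"
    using int by (simp add: sums_def)
qed

text \<open>The zeros at small positive reals accumulate at 0, while a power series with a nonzero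
  coefficient has isolated zeros. Positive real \<open>s\<close> are the right hypothesis because
  the generating functions below are supplied as integrals for such \<open>s\<close>.\<close>

lemma powser_coeff_eq_0:
  fixes a :: "nat \<Rightarrow> complex"
  assumes r: "0 < r" and zero: "\<And>s. 0 < s \<Longrightarrow> s < r \<Longrightarrow> (\<lambda>k. a k * of_real s ^ k) sums 0"
  shows "a m = 0"
proof -
  define f where "f z = (\<Sum>k. a k * (z - 0) ^ k)" for z :: complex
  have sm: "(\<lambda>k. a k * (z - 0) ^ k) sums f z" if "norm (z - 0) < r/2" for z
  proof -
    have "summable (\<lambda>k. a k * of_real (r/2) ^ k)"
      using zero[of "r/2"] r by (auto simp: sums_iff)
    then have "summable (\<lambda>k. a k * (z - 0) ^ k)"
      by (rule powser_inside) (use that r in auto)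
    then show ?thesis unfolding f_def by (rule summable_sums)
  qed
  have f0: "f (of_real s) = 0" if "0 < s" "s < r/2" for s
    using zero[of s] that unfolding f_def by (simp add: sums_iff)
  have "isCont f 0"
  proof -
    have "summable (\<lambda>k. a k * of_real (r/2) ^ k)"
      using zero[of "r/2"] r by (auto simp: sums_iff)
    then have "isCont (\<lambda>z. \<Sum>k. a k * z ^ k) 0"
      by (rule isCont_powser) (use r in auto)
    then show ?thesis by (simp add: f_def[abs_def])
  qed
  have lim: "((\<lambda>s. f (of_real s)) \<longlongrightarrow> f (of_real 0)) (at_right 0)"
    using \<open>isCont f 0\<close> by (intro tendsto_compose_filtermap isCont_tendsto_compose[of _ f] tendsto_intros) (auto simp: filterlim_def)
  have "\<forall>\<^sub>F s in at_right 0. f (of_real s) = 0"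
    using f0 r by (auto simp: eventually_at_right_field intro!: exI[of _ "r/2"])
  then have "((\<lambda>s. f (of_real s)) \<longlongrightarrow> 0) (at_right (0::real))"
    by (rule tendsto_eventually)
  with lim have f00: "f 0 = 0"
    using tendsto_unique[of "at_right (0::real)"] by fastforce
  \<comment> \<open>Index 0 is separate because \<open>powser_0_nonzero\<close> asks for
    \<open>f 0 = 0\<close> and a nonzero coefficient of positive index.\<close>
  show ?thesis
  proof (cases m)
    case 0
    then show ?thesis using f00 powser_zero[of a] by (simp add: f_def)
  next
    case (Suc n)
    show ?thesis
    proof (rule ccontr)
      assume am: "a m \<noteq> 0"
      obtain s where s: "0 < s" "\<And>z. z \<in> cball 0 s - {0} \<Longrightarrow> f z \<noteq> 0"
        by (rule powser_0_nonzero[of "r/2" 0 a f m]) (use sm f00 r Suc am in auto)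
      have "f (of_real (min s (r/4))) \<noteq> 0" using s r by (intro s(2)) auto
      then show False using f0[of "min s (r/4)"] s r by auto
    qed
  qed
qed

lemma has_bochner_integral_Gamma_scaled:
  fixes c t :: real
  assumes c: "c > 0" and t: "t > 0"
  shows "has_bochner_integral lborel (\<lambda>x. indicator {0..} x * (x powr (c - 1) * exp (- (t * x)))) (Gamma c * t powr (- c))"
proof -
  have "has_bochner_integral lborel (\<lambda>x. indicator {0..} x * (x powr (c - 1) * exp (- x))) (Gamma c)"
  proof (rule has_bochner_integral_nn_integral)
    show "(\<integral>\<^sup>+x. ennreal (indicator {0..} x * (x powr (c - 1) * exp (- x))) \<partial>lborel) = ennreal (Gamma c)"
      unfolding Gamma_conv_nn_integral_real[OF c] by (simp add: exp_minus divide_inverse mult.assoc)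
  qed (use c in auto)
  then have "has_bochner_integral lborel
      (\<lambda>x. indicator {0..} (t*x) * ((t*x) powr (c - 1) * exp (- (t*x)))) (Gamma c / t)"
    using t by (subst (asm) lborel_has_bochner_integral_real_affine_iff[where c=t and t=0]) (auto simp: divide_inverse mult.commute)
  then have "has_bochner_integral lborel
      (\<lambda>x. t powr (1 - c) * (indicator {0..} (t*x) * ((t*x) powr (c - 1) * exp (- (t*x))))) (t powr (1 - c) * (Gamma c / t))"
    by (intro has_bochner_integral_mult_right) auto
  moreover have "t powr (1 - c) * (indicator {0..} (t*x) * ((t*x) powr (c - 1) * exp (- (t*x))))
      = indicator {0..} x * (x powr (c - 1) * exp (- (t * x)))" for x
    using t by (auto simp: indicator_def zero_le_mult_iff powr_mult powr_diff field_simps)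
  moreover have "t powr (1 - c) * (Gamma c / t) = Gamma c * t powr (- c)"
    using t by (simp add: powr_diff powr_minus field_simps)
  ultimately show ?thesis by simp
qed

section \<open>Laplace integrals\<close>

text \<open>Termwise integration of an exponential series needs a majorant for the partial sums of
  norms; this is its source throughout.\<close>

lemma exp_partial_sum_le:
  fixes y :: real
  assumes "y \<ge> 0"
  shows "(\<Sum>k<N. y ^ k / fact k) \<le> exp y"
proof -
  have "(\<lambda>k. y ^ k / fact k) sums exp y"
    using exp_converges[of y] by (simp add: divide_inverse mult.commute)
  then show ?thesis
    using assms sum_le_suminf[of "\<lambda>k. y ^ k / fact k" "{..<N}"] by (auto simp: sums_iff)
qed

text \<open>Expanding \<open>exp (t q x)\<close> with \<open>t = |w|\<^sup>2 / Re w\<close> and \<open>w = t (1 - q)\<close>, \<open>|q| < 1\<close>, reduces the complex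
  rate \<open>w\<close> to the real rate \<open>t\<close> and the binomial series for \<open>1 - q\<close>; no contour is rotated.\<close>

lemma has_bochner_integral_Gamma_complex_scaled:
  fixes c :: real and w :: complex
  assumes c: "c > 0" and w: "Re w > 0"
  shows "has_bochner_integral lborel
    (\<lambda>x. of_real (indicator {0..} x * x powr (c - 1)) * exp (- (w * of_real x)))
    (of_real (Gamma c) * w powr (- of_real c))"
proof -
  \<comment> \<open>Among real \<open>u\<close>, \<open>norm (1 - u * w)\<close> is smallest at
    \<open>u = 1 / t\<close>, where it equals \<open>\<bar>Im w\<bar> / norm w\<close>, which is
    below 1 as \<open>Re w > 0\<close>.\<close>
  define t where "t = (norm w)\<^sup>2 / Re w"
  define q where "q = 1 - w / of_real t"
  have w0: "w \<noteq> 0" using w by auto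
  have t: "t > 0" using w w0 by (simp add: t_def)
  have q: "norm q < 1"
  proof -
    define u where "u = Re w / (norm w)\<^sup>2"
    have qu: "q = 1 - w * of_real u" using w w0 by (simp add: q_def t_def u_def)
    have uw: "u * ((Re w)\<^sup>2 + (Im w)\<^sup>2) = Re w" using w0 by (simp add: u_def cmod_power2[symmetric])
    have "(norm q)\<^sup>2 = 1 - 2 * u * Re w + u * (u * ((Re w)\<^sup>2 + (Im w)\<^sup>2))"
      unfolding qu cmod_power2 by (simp add: power2_eq_square algebra_simps)
    also have "\<dots> = 1 - u * Re w" by (simp only: uw)
    also have "\<dots> < 1" using w w0 by (simp add: u_def)
    finally show ?thesis by (simp add: power_less_one_iff abs_square_less_1)
  qed
  have tq: "of_real t - of_real t * q = w" using t by (simp add: q_def algebra_simps)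
  define f where "f k x = of_real (indicator {0..} x * (x powr (c - 1) * exp (- (t * x)))) *
      ((of_real t * q * of_real x) ^ k /\<^sub>R fact k)" for k and x :: real
  \<comment> \<open>Taking norms in the series for \<open>exp (t * q * x)\<close> leaves
    \<open>exp (- t * x) * exp (t * norm q * x)\<close>, which still decays since
    \<open>norm q < 1\<close>.\<close>
  define W where "W x = indicator {0..} x * (x powr (c - 1) * exp (- (t * (1 - norm q) * x)))" for x :: real
  have meas: "f k \<in> borel_measurable lborel" for k unfolding f_def by measurable
  have W: "integrable lborel W"
    unfolding W_def using has_bochner_integral_Gamma_scaled[of c "t * (1 - norm q)"] c t q
    by (auto simp: has_bochner_integral_iff)
  have sums: "(\<lambda>k. f k x) sums (of_real (indicator {0..} x * x powr (c - 1)) * exp (- (w * of_real x)))" for x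
  proof -
    have "(\<lambda>k. f k x) sums (of_real (indicator {0..} x * (x powr (c - 1) * exp (- (t * x)))) * exp (of_real t * q * of_real x))"
      unfolding f_def by (intro sums_mult exp_converges)
    moreover have "exp (- (of_real t * of_real x)) * exp (of_real t * q * of_real x) = exp (- (w * of_real x))"
      by (simp add: exp_add[symmetric] tq[symmetric] algebra_simps)
    ultimately show ?thesis by (simp add: exp_of_real[symmetric] mult.assoc)
  qed
  have bound: "(\<Sum>k<N. norm (f k x)) \<le> W x" for N x
  proof (cases "x \<ge> 0")
    case True
    have "(\<Sum>k<N. norm (f k x)) = x powr (c - 1) * exp (- (t * x)) * (\<Sum>k<N. (t * norm q * x) ^ k / fact k)"
      unfolding f_def using True t
      by (auto simp: norm_mult norm_power norm_divide sum_distrib_left divide_inverse mult_ac intro!: sum.cong)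
    also have "\<dots> \<le> x powr (c - 1) * exp (- (t * x)) * exp (t * norm q * x)"
      using True t by (intro mult_left_mono exp_partial_sum_le) auto
    also have "\<dots> = W x"
      using True by (simp add: W_def mult_exp_exp algebra_simps)
    finally show ?thesis .
  qed (simp add: f_def W_def)
  have int_f: "integral\<^sup>L lborel (f k) =
      of_real (Gamma c) * of_real (t powr (- c)) * ((- of_real c gchoose k) * (- q) ^ k)" for k
  proof -
    have eq: "f k x = (of_real t * q) ^ k / fact k *
        of_real (indicator {0..} x * (x powr (c + real k - 1) * exp (- (t * x))))" for x
    proof (cases "x > 0")
      case True
      then show ?thesis
        by (simp add: f_def powr_add powr_diff powr_realpow power_mult_distrib scaleR_conv_of_real field_simps)
    next
      \<comment> \<open>The origin is harmless: \<open>0 powr s = 0\<close> for every exponent, so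
        both sides vanish there.\<close>
      case False
      then show ?thesis using c by (cases "x = 0") (auto simp: f_def)
    qed
    have I: "has_bochner_integral lborel (\<lambda>x. indicator {0..} x * (x powr (c + real k - 1) * exp (- (t * x))))
        (Gamma (c + real k) * t powr (- (c + real k)))"
      using c t by (intro has_bochner_integral_Gamma_scaled) auto
    have "integral\<^sup>L lborel (f k) = (of_real t * q) ^ k / fact k * of_real (Gamma (c + real k) * t powr (- (c + real k)))"
      unfolding eq using I by (simp only: integral_mult_right_zero integral_complex_of_real has_bochner_integral_iff)
    also have "Gamma (c + real k) = Gamma c * pochhammer c k"
    proof -
      have "Gamma c \<noteq> 0" using Gamma_real_pos[OF c] by simp
      moreover have "c \<notin> \<int>\<^sub>\<le>\<^sub>0" using c by (auto elim!: nonpos_Ints_cases)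
      ultimately show ?thesis by (simp add: pochhammer_Gamma)
    qed
    also have "t powr (- (c + real k)) = t powr (- c) / t ^ k"
      using t by (simp add: powr_diff powr_realpow)
    finally show ?thesis
      using t by (simp add: gbinomial_pochhammer pochhammer_of_real power_mult_distrib power_minus[of q] field_simps)
  qed
  have S1: "(\<lambda>k. integral\<^sup>L lborel (f k)) sums
      (\<integral>x. (of_real (indicator {0..} x * x powr (c - 1)) * exp (- (w * of_real x))) \<partial>lborel)"
    by (rule integral_sums_dominated[OF meas W]) (use sums bound in auto)
  have S2: "(\<lambda>k. integral\<^sup>L lborel (f k)) sums
      (of_real (Gamma c) * of_real (t powr (- c)) * (1 + - q) powr (- of_real c))"
    unfolding int_f by (intro sums_mult gen_binomial_complex) (use q in simp)
  have eq: "of_real (t powr (- c)) * (1 + - q) powr (- of_real c) = w powr (- of_real c)"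
  proof -
    have "w = of_real t * (1 + - q)" using tq by (simp add: algebra_simps)
    then have "w powr (- of_real c) = (of_real t * (1 + - q)) powr (- of_real c)" by simp
    \<comment> \<open>The principal power is multiplicative here because \<open>t\<close> is a
      positive real.\<close>
    also have "\<dots> = of_real t powr (- of_real c) * (1 + - q) powr (- of_real c)"
      using t by (intro powr_times_real_left) auto
    also have "of_real t powr (- of_real c) = complex_of_real (t powr (- c))"
      using t powr_of_real[of t "-c"] by simp
    finally show ?thesis by simp
  qed
  from sums_unique2[OF S1 S2] have "(\<integral>x. (of_real (indicator {0..} x * x powr (c - 1)) * exp (- (w * of_real x))) \<partial>lborel)
      = of_real (Gamma c) * w powr (- of_real c)"
    by (simp only: mult.assoc eq)
  moreover have "integrable lborel (\<lambda>x. of_real (indicator {0..} x * x powr (c - 1)) * exp (- (w * of_real x)))"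
    by (rule integrable_sums_dominated[OF meas W]) (use sums bound in auto)
  ultimately show ?thesis by (simp add: has_bochner_integral_iff)
qed

text \<open>Watson's lemma with an explicit remainder. The terms \<open>1\<close> and
  \<open>b * x\<close> of \<open>g\<close> give exact Gamma integrals; the rest is dominated by
  \<open>K * x^2\<close> and integrated after replacing \<open>exp (- w * x)\<close> by its norm.
  This last step is why the bound contains \<open>Re w\<close> and not
  \<open>norm w\<close>.\<close>

lemma Laplace_two_term_bound:
  fixes c b K :: real and w :: complex and g :: "real \<Rightarrow> real"
  assumes c: "c > 0" and w: "Re w > 0" and [measurable]: "g \<in> borel_measurable borel"
    and g: "\<And>x. x \<ge> 0 \<Longrightarrow> \<bar>g x - 1 - b * x\<bar> \<le> K * x\<^sup>2"
  shows "norm ((\<integral>x. of_real (indicator {0..} x * x powr (c - 1) * g x) * exp (- (w * of_real x)) \<partial>lborel)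
      - of_real (Gamma c) * w powr (- of_real c) - of_real (b * Gamma (c + 1)) * w powr (- of_real (c + 1)))
    \<le> K * (Gamma (c + 2) * Re w powr (- (c + 2)))"
proof -
  define e where "e k x = of_real (indicator {0..} x * x powr (c + k - 1)) * exp (- (w * of_real x))" for k x :: real
  define D where "D x = of_real (indicator {0..} x * x powr (c - 1) * (g x - 1 - b * x)) * exp (- (w * of_real x))" for x :: real
  have e: "has_bochner_integral lborel (e k) (of_real (Gamma (c + k)) * w powr (- of_real (c + k)))" if "k \<ge> 0" for k
    unfolding e_def using has_bochner_integral_Gamma_complex_scaled[of "c + k" w] c w that by simp
  have W: "has_bochner_integral lborel (\<lambda>x. K * (indicator {0..} x * (x powr (c + 2 - 1) * exp (- (Re w * x)))))
      (K * (Gamma (c + 2) * Re w powr (- (c + 2))))"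
    by (intro has_bochner_integral_mult_right has_bochner_integral_Gamma_scaled) (use c w in auto)
  have DW: "norm (D x) \<le> K * (indicator {0..} x * (x powr (c + 2 - 1) * exp (- (Re w * x))))" for x
  proof (cases "x > 0")
    case True
    have "x powr (1 + c) = x powr (c - 1) * x\<^sup>2"
      using True by (simp add: powr_numeral[symmetric] powr_add[symmetric] add.commute del: powr_numeral)
    then show ?thesis
      using True mult_left_mono[OF g[of x], of "x powr (c - 1) * exp (- (Re w * x))"]
      unfolding D_def norm_mult[of "of_real _"] norm_of_real
      by (simp add: abs_mult mult_ac add.commute[of c 1])
  next
    case False
    then show ?thesis using c by (cases "x = 0") (auto simp: D_def)
  qed
  have D: "integrable lborel D"
  proof (rule Bochner_Integration.integrable_bound)
    show "D \<in> borel_measurable lborel" unfolding D_def by measurable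
    show "AE x in lborel. norm (D x) \<le> norm (K * (indicator {0..} x * (x powr (c + 2 - 1) * exp (- (Re w * x)))))"
      using DW by (intro AE_I2) (metis abs_ge_self order_trans real_norm_def)
  qed (use W in \<open>simp add: has_bochner_integral_iff\<close>)
  have eq: "of_real (indicator {0..} x * x powr (c - 1) * g x) * exp (- (w * of_real x)) = D x + e 0 x + of_real b * e 1 x" for x
  proof (cases "x > 0")
    case True
    then show ?thesis by (simp add: D_def e_def powr_diff field_simps)
  next
    case False
    then show ?thesis using c by (cases "x = 0") (auto simp: D_def e_def)
  qed
  have "(\<integral>x. of_real (indicator {0..} x * x powr (c - 1) * g x) * exp (- (w * of_real x)) \<partial>lborel)
      = integral\<^sup>L lborel D + of_real (Gamma c) * w powr (- of_real c) + of_real b * (of_real (Gamma (c + 1)) * w powr (- of_real (c + 1)))"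
    unfolding eq using D e[of 0] e[of 1]
    by (subst Bochner_Integration.integral_add)
       (auto simp: has_bochner_integral_iff)
  moreover have "norm (integral\<^sup>L lborel D) \<le> K * (Gamma (c + 2) * Re w powr (- (c + 2)))"
    using Bochner_Integration.integral_norm_bound_integral[OF D] W DW by (metis (no_types, lifting) has_bochner_integral_iff)
  ultimately show ?thesis by (simp add: mult.assoc)
qed

text \<open>Watson's lemma wants one quadratic bound on the whole half-line. Near 0 it is Taylor's
  formula; away from 0 the truncated power stays in \<open>[0,1]\<close>, and constants and linear
  terms are dominated by \<open>x^2\<close>.\<close>

lemma truncated_power_two_term:
  fixes m :: real
  assumes "m > 0"
  obtains K where "\<And>x. x \<ge> 0 \<Longrightarrow> \<bar>(if x < 1 then (1 - x) powr m else 0) - 1 - (- m) * x\<bar> \<le> K * x\<^sup>2"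
proof -
  have "(\<lambda>x. (1 - x) powr m - 1 + m * x) \<in> O[at_right 0](\<lambda>x::real. x\<^sup>2)" by real_asymp
  then obtain C where C: "\<forall>\<^sub>F x in at_right (0::real). norm ((1 - x) powr m - 1 + m * x) \<le> C * norm (x\<^sup>2)"
    by (auto elim: landau_o.bigE)
  then obtain r where r: "r > 0" "\<And>x. 0 < x \<Longrightarrow> x < r \<Longrightarrow> norm ((1 - x) powr m - 1 + m * x) \<le> C * x\<^sup>2"
    by (auto simp: eventually_at_right_field)
  define d where "d = min 1 r"
  have d: "d > 0" "d \<le> 1" "d \<le> r" using r by (auto simp: d_def)
  \<comment> \<open>\<open>C\<close> serves \<open>x < d\<close>. For \<open>x \<ge> d\<close>,
    \<open>1 \<le> x / d\<close> turns the bound \<open>2 + m * x\<close> into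
    \<open>(2 / d^2 + m / d) * x^2\<close>.\<close>
  define K where "K = \<bar>C\<bar> + 2 / d\<^sup>2 + m / d"
  show thesis
  proof (rule that[of K])
    fix x :: real assume x: "x \<ge> 0"
    consider "x = 0" | "0 < x" "x < d" | "d \<le> x" using x by linarith
    then show "\<bar>(if x < 1 then (1 - x) powr m else 0) - 1 - (- m) * x\<bar> \<le> K * x\<^sup>2"
    proof cases
      case 2
      have "norm ((1 - x) powr m - 1 + m * x) \<le> C * x\<^sup>2" using 2 d r by auto
      also have "\<dots> \<le> K * x\<^sup>2"
      proof (intro mult_right_mono)
        have "0 \<le> 2 / d\<^sup>2" "0 \<le> m / d" using assms d by auto
        then show "C \<le> K" unfolding K_def using abs_ge_self[of C] by linarith
      qed simp
      finally show ?thesis using 2 d by simp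
    next
      case 3
      define g where "g = (if x < 1 then (1 - x) powr m else 0)"
      have "0 \<le> g" "g \<le> 1" using x assms powr_mono2[of m "1 - x" 1] by (auto simp: g_def)
      moreover have "0 \<le> m * x" using x assms by auto
      ultimately have "\<bar>(if x < 1 then (1 - x) powr m else 0) - 1 - (- m) * x\<bar> \<le> 2 + m * x"
        unfolding g_def[symmetric] by linarith
      also have "\<dots> \<le> 2 * (x/d)\<^sup>2 + m * x * (x / d)"
      proof (intro add_mono)
        have "1 \<le> x / d" using 3 d by simp
        then show "2 \<le> 2 * (x/d)\<^sup>2" "m * x \<le> m * x * (x / d)"
          using assms x power_mono[of 1 "x/d" 2] mult_left_mono[of 1 "x/d" "m * x"] by auto
      qed
      also have "\<dots> = (2 / d\<^sup>2 + m / d) * x\<^sup>2" by (simp add: power2_eq_square field_simps)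
      also have "\<dots> \<le> K * x\<^sup>2" by (intro mult_right_mono) (auto simp: K_def)
      finally show ?thesis .
    qed simp
  qed
qed

section \<open>The hypergeometric function 0F1\<close>

text \<open>At \<open>u = v^2\<close> this is \<open>I\<close> of order \<open>a - 1\<close> at
  \<open>2 * v\<close>, times \<open>Gamma a * v powr (1 - a)\<close>. For \<open>a > 0\<close> the
  series is entire in \<open>u\<close>, so branches enter only where powers are put back.\<close>

definition hyp0F1 :: "real \<Rightarrow> complex \<Rightarrow> complex" where
  "hyp0F1 a u = (\<Sum>k. u ^ k / of_real (fact k * pochhammer a k))"

lemma summable_hyp0F1:
  assumes "a > 0"
  shows "summable (\<lambda>k. norm (u ^ k / complex_of_real (fact k * pochhammer a k)))"
proof -
  have norm_term: "norm (u ^ k / complex_of_real (fact k * pochhammer a k)) = norm u ^ k / (fact k * pochhammer a k)" for k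
    using pochhammer_pos[OF assms, of k] by (simp only: norm_divide norm_power norm_of_real) simp
  show ?thesis
    unfolding norm_term
  proof (rule summable_ratio_test[where c="1/2" and N="nat \<lceil>2 * norm u / a\<rceil>"])
  fix n assume n: "nat \<lceil>2 * norm u / a\<rceil> \<le> n"
  then have "2 * norm u / a \<le> real n" by linarith
  then have "2 * norm u \<le> real n * a" using assms by (simp add: field_simps)
  also have "\<dots> \<le> (1 + real n) * (a + real n)" using assms by (simp add: algebra_simps)
  finally have "norm u / ((1 + real n) * (a + real n)) \<le> 1/2"
    using assms by (subst pos_divide_le_eq) (auto simp: add_pos_nonneg)
  then have "norm u / ((1 + real n) * (a + real n)) * (norm u ^ n / (fact n * pochhammer a n)) \<le> 1/2 * (norm u ^ n / (fact n * pochhammer a n))"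
    using assms pochhammer_pos[of a n] by (intro mult_right_mono) auto
  then show "norm (norm u ^ Suc n / (fact (Suc n) * pochhammer a (Suc n))) \<le> 1/2 * norm (norm u ^ n / (fact n * pochhammer a n))"
    using assms pochhammer_pos[of a n] by (simp add: pochhammer_Suc mult_ac)
  qed simp
qed

lemma hyp0F1_sums:
  "a > 0 \<Longrightarrow> (\<lambda>k. u ^ k / of_real (fact k * pochhammer a k)) sums hyp0F1 a u"
  unfolding hyp0F1_def by (rule summable_sums[OF summable_norm_cancel[OF summable_hyp0F1]])

text \<open>This is the three-term recurrence for the Bessel functions \<open>I\<close> of orders
  \<open>a - 1\<close>, \<open>a\<close>, \<open>a + 1\<close>, free of branches. Termwise,
  \<open>1 / (a)_k - 1 / (a+1)_k = k / (a * (a+1)_k)\<close>; the factor \<open>k\<close> cancels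
  against \<open>k!\<close>, and \<open>(a+1)_k = (a+1) * (a+2)_(k-1)\<close> shifts the
  index.\<close>

lemma hyp0F1_contiguous:
  assumes "a > 0"
  shows "hyp0F1 a u = hyp0F1 (a + 1) u + u / of_real (a * (a + 1)) * hyp0F1 (a + 2) u"
proof -
  let ?T = "\<lambda>a k. u ^ k / complex_of_real (fact k * pochhammer a k)"
  have p1: "a * pochhammer (a + 1) k = pochhammer a k * (a + real k)" for k
    using pochhammer_rec[of a k] pochhammer_Suc[of a k] by simp
  have p2: "(a + 1) * pochhammer (a + 2) k = pochhammer (a + 1) (Suc k)" for k
    using pochhammer_rec[of "a + 1" k] by (simp add: add.commute)
  have step: "?T a k - ?T (a + 1) k = (case k of 0 \<Rightarrow> 0 | Suc j \<Rightarrow> u / of_real (a * (a + 1)) * ?T (a + 2) j)" for k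
  proof (cases k)
    case (Suc j)
    have pos: "pochhammer a (Suc j) > 0" "pochhammer (a + 1) (Suc j) > 0" "pochhammer (a + 2) j > 0"
      using assms by (auto intro: pochhammer_pos)
    have "1 / (fact (Suc j) * pochhammer a (Suc j)) - 1 / (fact (Suc j) * pochhammer (a + 1) (Suc j))
        = 1 / (a * (a + 1)) / (fact j * pochhammer (a + 2) j)"
    proof -
      \<comment> \<open>The Pochhammer symbols are abstracted to \<open>P\<close>, \<open>Q\<close>,
        \<open>R\<close>, with \<open>p1\<close> and \<open>p2\<close> as their only relations, so
        that the simplifier does not unfold them.\<close>
      have frac: "1 / (S * f * P) - 1 / (S * f * R) = 1 / (a * (a + 1)) / (f * Q)"
        if "S > 0" "f > 0" "Q > 0" "a * R = P * (a + S)" "(a + 1) * Q = R" for S f P Q R :: real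
      proof -
        have "P = a * ((a + 1) * Q) / (a + S)" using that assms by (simp add: eq_divide_eq)
        then have "1 / (S * f * P) = (a + S) / (S * f * (a * ((a + 1) * Q)))" by simp
        moreover have "1 / (S * f * R) = a / (S * f * (a * ((a + 1) * Q)))"
          using that(5) assms by simp
        ultimately have "1 / (S * f * P) - 1 / (S * f * R) = S / (S * f * (a * ((a + 1) * Q)))"
          by (simp only: diff_divide_distrib[symmetric]) simp
        then show ?thesis using that(1) by (simp add: mult_ac)
      qed
      have "(1 + real j) * fact j = (fact (Suc j) :: real)" by simp
      then show ?thesis
        using frac[of "real (Suc j)" "fact j" "pochhammer (a + 2) j" "pochhammer (a + 1) (Suc j)" "pochhammer a (Suc j)"]
          p1[of "Suc j"] p2[of j] pos by simp
    qed
    then have "u ^ Suc j * complex_of_real (1 / (fact (Suc j) * pochhammer a (Suc j)) - 1 / (fact (Suc j) * pochhammer (a + 1) (Suc j)))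
        = u ^ Suc j * complex_of_real (1 / (a * (a + 1)) / (fact j * pochhammer (a + 2) j))" by (rule arg_cong)
    moreover have "u ^ Suc j * complex_of_real (1 / (a * (a + 1)) / (fact j * pochhammer (a + 2) j))
        = u / of_real (a * (a + 1)) * ?T (a + 2) j"
      by (simp only: of_real_divide of_real_1 divide_inverse power_Suc mult_ac mult_1_left
          of_real_mult of_real_inverse inverse_mult_distrib)
    moreover have "?T b (Suc j) = u ^ Suc j * complex_of_real (1 / (fact (Suc j) * pochhammer b (Suc j)))" for b
      by (simp only: of_real_divide of_real_1 divide_inverse mult_1_left of_real_inverse)
    ultimately show ?thesis
      unfolding Suc nat.case by (simp only: of_real_diff right_diff_distrib)
  qed simp
  have "(\<lambda>k. ?T a k - ?T (a + 1) k) sums (hyp0F1 a u - hyp0F1 (a + 1) u)"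
    using assms by (intro sums_diff hyp0F1_sums) auto
  moreover have "(\<lambda>k. ?T a k - ?T (a + 1) k) sums (u / of_real (a * (a + 1)) * hyp0F1 (a + 2) u)"
  proof -
    have "(\<lambda>k. ?T a (Suc k) - ?T (a + 1) (Suc k)) sums (u / of_real (a * (a + 1)) * hyp0F1 (a + 2) u)"
      unfolding step nat.case using assms by (intro sums_mult hyp0F1_sums) auto
    then show ?thesis by (subst (asm) sums_Suc_iff) simp
  qed
  ultimately have "hyp0F1 a u - hyp0F1 (a + 1) u = u / of_real (a * (a + 1)) * hyp0F1 (a + 2) u"
    by (rule sums_unique2)
  then show ?thesis by (simp add: algebra_simps)
qed

section \<open>Poisson's integral for 0F1, from the moments of \<open>1 - 2 * x\<close> under a
  symmetric Beta weight\<close>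

lemma symmetric_Beta_moments:
  fixes m :: real
  assumes m: "m > 0"
  defines "J k \<equiv> integral {0..1} (\<lambda>x. (1 - 2 * x) ^ k * (x * (1 - x)) powr m)"
  shows "J (2 * k) = Beta (m + 1) (m + 1) * (fact (2 * k) / (4 ^ k * fact k * pochhammer (m + 3/2) k))"
    and "J (2 * k + 1) = 0"
proof -
  have J: "((\<lambda>x. (1 - 2 * x) ^ k * (x * (1 - x)) powr m) has_integral J k) {0..1}" for k
    unfolding J_def by (intro integrable_integral integrable_continuous_real continuous_intros continuous_on_powr') (use m in auto)
  have J0: "J 0 = Beta (m + 1) (m + 1)"
    using has_integral_Beta_real[of "m + 1" "m + 1"] m
    by (auto simp: J_def powr_mult intro!: integral_unique elim!: has_integral_eq[rotated])
  \<comment> \<open>For \<open>k = 0\<close> the truncated index \<open>k - 1\<close> does no harm,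
    as its coefficient is 0; this case yields \<open>J 1 = 0\<close>, from which all odd moments
    vanish.\<close>
  have rec: "(2 * m + 2 + real k) * J (k + 1) = real k * J (k - 1)" for k
  proof -
    \<comment> \<open>\<open>?F\<close> vanishes at both endpoints, so its derivative integrates to
      0. Rewriting \<open>4 * x * (1 - x) = 1 - (1 - 2 * x)^2\<close> makes that derivative a
      combination of two moment integrands.\<close>
    let ?F = "\<lambda>x. (1 - 2 * x) ^ k * (x * (1 - x)) powr (m + 1)"
    let ?F' = "\<lambda>x. (m + 1 + real k / 2) * ((1 - 2 * x) ^ (k + 1) * (x * (1 - x)) powr m)
        - real k / 2 * ((1 - 2 * x) ^ (k - 1) * (x * (1 - x)) powr m)"
    have "(?F' has_integral ?F 1 - ?F 0) {0..1}"
    proof (rule fundamental_theorem_of_calculus_interior)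
      show "continuous_on {0..1} ?F" by (intro continuous_intros continuous_on_powr') (use m in auto)
      fix x :: real assume "x \<in> {0<..<1}"
      then have x: "0 < x" "x < 1" "0 < x * (1 - x)" by auto
      have pw: "(x * (1 - x)) powr (m + 1) = x * (1 - x) * (x * (1 - x)) powr m"
        using x by (simp add: powr_add)
      have "(?F has_real_derivative
          (real k * (1 - 2 * x) ^ (k - 1) * (- 2)) * (x * (1 - x)) powr (m + 1) +
          (1 - 2 * x) ^ k * ((m + 1) * (x * (1 - x)) powr m * (1 - 2 * x))) (at x)"
        using x by (auto intro!: derivative_eq_intros simp: algebra_simps)
      also have "(real k * (1 - 2 * x) ^ (k - 1) * (- 2)) * (x * (1 - x)) powr (m + 1) +
          (1 - 2 * x) ^ k * ((m + 1) * (x * (1 - x)) powr m * (1 - 2 * x)) = ?F' x"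
      proof (cases k)
        case (Suc j)
        have "real k * (1 - 2 * x) ^ j * (- 2) * (x * (1 - x) * P) + (1 - 2 * x) ^ k * ((m + 1) * P * (1 - 2 * x))
          = (m + 1 + real k / 2) * ((1 - 2 * x) ^ (k + 1) * P) - real k / 2 * ((1 - 2 * x) ^ j * P)" for P
          unfolding Suc by (simp add: field_simps power2_eq_square)
        then show ?thesis unfolding pw by (simp add: Suc)
      qed (simp add: algebra_simps)
      finally show "(?F has_vector_derivative ?F' x) (at x)"
        by (simp add: has_real_derivative_iff_has_vector_derivative)
    qed simp
    moreover have "(?F' has_integral (m + 1 + real k / 2) * J (k + 1) - real k / 2 * J (k - 1)) {0..1}"
      by (intro has_integral_diff has_integral_mult_right J)
    ultimately have "(m + 1 + real k / 2) * J (k + 1) - real k / 2 * J (k - 1) = ?F 1 - ?F 0"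
      by (rule has_integral_unique[rotated])
    then show ?thesis using m by (simp add: field_simps)
  qed
  show "J (2 * k + 1) = 0"
  proof (induction k)
    case 0
    then show ?case using rec[of 0] m by simp
  next
    case (Suc k)
    then show ?case using rec[of "2 * k + 2"] m by (simp add: add_pos_nonneg)
  qed
  show "J (2 * k) = Beta (m + 1) (m + 1) * (fact (2 * k) / (4 ^ k * fact k * pochhammer (m + 3/2) k))"
  proof (induction k)
    case 0
    then show ?case by (simp add: J0)
  next
    case (Suc k)
    have pos: "pochhammer (m + 3/2) k > 0" using m by (intro pochhammer_pos) auto
    have "J (2 * Suc k) = real (2 * k + 1) / (2 * (m + 3/2 + real k)) * J (2 * k)"
      using rec[of "2 * k + 1"] m by (simp add: field_simps)
    also have "\<dots> = real (2 * k + 1) / (2 * (m + 3/2 + real k)) * (fact (2 * k) / (4 ^ k * fact k * pochhammer (m + 3/2) k)) * Beta (m + 1) (m + 1)"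
      unfolding Suc by simp
    also have "real (2 * k + 1) / (2 * (m + 3/2 + real k)) * (fact (2 * k) / (4 ^ k * fact k * pochhammer (m + 3/2) k))
        = fact (2 * Suc k) / (4 ^ Suc k * fact (Suc k) * pochhammer (m + 3/2) (Suc k))"
    proof -
      have "fact (2 * Suc k) = 2 * (real k + 1) * (real (2 * k + 1) * fact (2 * k))"
        by (simp add: algebra_simps)
      moreover have "4 ^ Suc k * fact (Suc k) * pochhammer (m + 3/2) (Suc k)
          = 2 * (real k + 1) * ((2 * (m + 3/2 + real k)) * (4 ^ k * fact k * pochhammer (m + 3/2) k))"
        by (simp add: pochhammer_Suc algebra_simps)
      ultimately show ?thesis by (simp only: mult_divide_mult_cancel_left times_divide_times_eq) simp
    qed
    finally show ?case by simp
  qed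
qed

text \<open>Expand the exponential: odd moments vanish, and in the even ones \<open>(2 * k)!\<close>
  and \<open>4 ^ k\<close> cancel against the moment formula. The variable runs over
  \<open>[0,1]\<close> rather than \<open>[-1,1]\<close> so that \<open>exp (2 * v)\<close> can be
  split off at the dominant endpoint \<open>x = 0\<close>.\<close>

lemma hyp0F1_Poisson_integral:
  fixes m :: real and v :: complex
  assumes m: "m > 0"
  shows "(\<integral>x. of_real (indicator {0..1} x * (x * (1 - x)) powr m) * exp (2 * v * of_real (1 - 2 * x)) \<partial>lborel)
    = of_real (Beta (m + 1) (m + 1)) * hyp0F1 (m + 3/2) (v\<^sup>2)"
proof -
  define J where "J k = integral {0..1} (\<lambda>x. (1 - 2 * x) ^ k * (x * (1 - x)) powr m)" for k
  define f where "f k x = of_real (indicator {0..1} x * (x * (1 - x)) powr m) * ((2 * v * of_real (1 - 2 * x)) ^ k /\<^sub>R fact k)" for k and x :: real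
  define W where "W x = exp (2 * norm v) * indicator {0..1} x" for x :: real
  have W: "integrable lborel W" unfolding W_def by simp
  have meas: "f k \<in> borel_measurable lborel" for k unfolding f_def by measurable
  have bound: "(\<Sum>k<N. norm (f k x)) \<le> W x" for N x
  proof (cases "x \<in> {0..1}")
    case True
    then have "(x * (1 - x)) powr m \<le> 1" using m by (intro powr_le1) (auto intro: mult_nonneg_nonneg mult_le_one)
    moreover have "norm (2 * v * of_real (1 - 2 * x)) ^ k \<le> (2 * norm v) ^ k" for k
    proof (rule power_mono)
      have "norm (complex_of_real (1 - 2 * x)) \<le> 1" unfolding norm_of_real using True by (auto simp: abs_le_iff)
      then show "norm (2 * v * of_real (1 - 2 * x)) \<le> 2 * norm v"
        using mult_left_le[of "norm (complex_of_real (1 - 2 * x))" "norm (2 * v)"]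
        by (simp only: norm_mult[of "2 * v"] norm_mult[of 2 v] norm_numeral norm_ge_zero mult_nonneg_nonneg zero_le_numeral)
    qed simp
    moreover have "norm (f k x) = (x * (1 - x)) powr m * (norm (2 * v * of_real (1 - 2 * x)) ^ k / fact k)" for k
      unfolding f_def norm_mult[of "of_real _"] norm_of_real norm_scaleR norm_power using True
      by (simp add: divide_inverse mult.commute)
    ultimately have "norm (f k x) \<le> 1 * ((2 * norm v) ^ k / fact k)" for k
      by (simp only:) (intro mult_mono divide_right_mono, auto)
    then have "(\<Sum>k<N. norm (f k x)) \<le> (\<Sum>k<N. (2 * norm v) ^ k / fact k)" by (intro sum_mono) auto
    also have "\<dots> \<le> exp (2 * norm v)" by (intro exp_partial_sum_le) auto
    finally show ?thesis using True by (simp add: W_def)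
  qed (auto simp: f_def W_def)
  have int_f: "integral\<^sup>L lborel (f k) = (2 * v) ^ k / fact k * of_real (J k)" for k
  proof -
    have "(\<integral>x. indicator {0..1} x * ((1 - 2 * x) ^ k * (x * (1 - x)) powr m) \<partial>lborel) = J k"
    proof -
      have "set_integrable lborel {0..1} (\<lambda>x. (1 - 2 * x) ^ k * (x * (1 - x)) powr m)"
        by (intro borel_integrable_atLeastAtMost' continuous_intros continuous_on_powr') (use m in auto)
      from set_borel_integral_eq_integral(2)[OF this] show ?thesis
        by (simp add: J_def set_lebesgue_integral_def)
    qed
    moreover have "f k = (\<lambda>x. (2 * v) ^ k / fact k * of_real (indicator {0..1} x * ((1 - 2 * x) ^ k * (x * (1 - x)) powr m)))"
    proof
      fix x
      have "(2 * v * of_real (1 - 2 * x)) ^ k = (2 * v) ^ k * of_real ((1 - 2 * x) ^ k)"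
        by (simp only: power_mult_distrib of_real_power)
      then show "f k x = (2 * v) ^ k / fact k * of_real (indicator {0..1} x * ((1 - 2 * x) ^ k * (x * (1 - x)) powr m))"
        by (simp only: f_def of_real_mult scaleR_conv_of_real divide_inverse of_real_inverse of_real_fact mult_ac)
    qed
    ultimately show ?thesis by (simp only: integral_mult_right_zero integral_complex_of_real)
  qed
  have "(\<lambda>k. integral\<^sup>L lborel (f k)) sums
      (\<integral>x. of_real (indicator {0..1} x * (x * (1 - x)) powr m) * exp (2 * v * of_real (1 - 2 * x)) \<partial>lborel)"
    by (rule integral_sums_dominated[OF meas W _ bound]) (unfold f_def, intro sums_mult exp_converges)
  then have "(\<lambda>k. integral\<^sup>L lborel (f (2 * k))) sums
      (\<integral>x. of_real (indicator {0..1} x * (x * (1 - x)) powr m) * exp (2 * v * of_real (1 - 2 * x)) \<partial>lborel)"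
  proof (subst sums_mono_reindex)
    fix n :: nat assume "n \<notin> range ((*) 2)"
    then have "odd n" by (auto elim!: evenE)
    then show "integral\<^sup>L lborel (f n) = 0"
      using symmetric_Beta_moments(2)[OF m, of "n div 2"] by (auto simp: int_f J_def elim!: oddE)
  qed (auto simp: strict_mono_def)
  moreover have "integral\<^sup>L lborel (f (2 * k)) = of_real (Beta (m + 1) (m + 1)) * ((v\<^sup>2) ^ k / of_real (fact k * pochhammer (m + 3/2) k))" for k
  proof -
    have "(2 * v) ^ (2 * k) = 4 ^ k * (v\<^sup>2) ^ k" by (simp add: power_mult power_mult_distrib)
    moreover have "J (2 * k) = Beta (m + 1) (m + 1) * (fact (2 * k) / (4 ^ k * fact k * pochhammer (m + 3/2) k))"
      unfolding J_def by (rule symmetric_Beta_moments(1)[OF m])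
    ultimately show ?thesis unfolding int_f by (simp add: field_simps)
  qed
  moreover have "(\<lambda>k. of_real (Beta (m + 1) (m + 1)) * ((v\<^sup>2) ^ k / of_real (fact k * pochhammer (m + 3/2) k)))
      sums (of_real (Beta (m + 1) (m + 1)) * hyp0F1 (m + 3/2) (v\<^sup>2))"
    using m by (intro sums_mult hyp0F1_sums) auto
  ultimately show ?thesis by (simp add: sums_unique2)
qed

section \<open>Asymptotics of 0F1 in the right half-plane\<close>

lemma Gamma_plus1_pos:
  fixes c :: real
  assumes "c > 0"
  shows "Gamma (c + 1) = c * Gamma c"
  using assms by (intro Gamma_plus1) (auto elim!: nonpos_Ints_cases)

lemma Gamma_legendre_duplication_real:
  fixes c :: real
  assumes "c > 0"
  shows "Gamma c * Gamma (c + 1/2) = 2 powr (1 - 2 * c) * sqrt pi * Gamma (2 * c)"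
proof -
  have half: "complex_of_real c + 1/2 = of_real (c + 1/2)" and double: "2 * complex_of_real c = of_real (2 * c)"
    by simp_all
  have ex: "exp ((1 - 2 * complex_of_real c) * of_real (ln 2)) = of_real (2 powr (1 - 2 * c))"
    unfolding double by (simp add: powr_def exp_of_real[symmetric])
  have "complex_of_real c \<notin> \<int>\<^sub>\<le>\<^sub>0" "complex_of_real (c + 1/2) \<notin> \<int>\<^sub>\<le>\<^sub>0"
    using assms by (simp_all only: of_real_in_nonpos_Ints_iff) (auto elim!: nonpos_Ints_cases)
  then have "complex_of_real (Gamma c * Gamma (c + 1/2)) = complex_of_real (2 powr (1 - 2 * c) * sqrt pi * Gamma (2 * c))"
    using Gamma_legendre_duplication[of "complex_of_real c"]
    unfolding ex unfolding half double Gamma_complex_of_real by (simp only: of_real_mult simp_thms)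
  then show ?thesis by (simp only: of_real_eq_iff)
qed

text \<open>0F1 divided by its leading behaviour
  \<open>Gamma a / (2 * sqrt pi) * v powr (1/2 - a) * exp (2 * v)\<close>, so that the claim becomes
  an expansion starting with 1.\<close>

definition scaled_hyp0F1 :: "real \<Rightarrow> complex \<Rightarrow> complex" where
  "scaled_hyp0F1 a v = of_real (2 * sqrt pi / Gamma a) * v powr of_real (a - 1/2) * exp (- (2 * v)) * hyp0F1 a (v\<^sup>2)"

definition scaled_hyp0F1_error :: "real \<Rightarrow> complex \<Rightarrow> complex" where
  "scaled_hyp0F1_error a v = scaled_hyp0F1 a v - (1 - of_real ((a - 3/2) * (a - 1/2)) / (4 * v))"

text \<open>The normalisation absorbs the Gamma quotients and powers of \<open>v\<close>, leaving
  the coefficients \<open>a / v\<close> and \<open>1\<close>. Expansions can then be transported by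
  plain arithmetic.\<close>

lemma scaled_hyp0F1_contiguous:
  assumes a: "a > 0" and v: "v \<noteq> 0"
  shows "scaled_hyp0F1 a v = of_real a / v * scaled_hyp0F1 (a + 1) v + scaled_hyp0F1 (a + 2) v"
proof -
  have G1: "Gamma (a + 1) = a * Gamma a" by (rule Gamma_plus1_pos[OF a])
  have G2: "Gamma (a + 2) = (a + 1) * (a * Gamma a)"
    using a Gamma_plus1_pos[of "a + 1"] G1 by (simp add: add.assoc)
  have G: "Gamma a > 0" using a by (rule Gamma_real_pos)
  have p1: "v powr of_real (a + 1 - 1/2) = v * v powr of_real (a - 1/2)"
  proof -
    have "complex_of_real (a + 1 - 1/2) = 1 + of_real (a - 1/2)" by simp
    then show ?thesis using v by (simp only: powr_add) simp
  qed
  have p2: "v powr of_real (a + 2 - 1/2) = v\<^sup>2 * v powr of_real (a - 1/2)"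
  proof -
    have "complex_of_real (a + 2 - 1/2) = 2 + of_real (a - 1/2)" by simp
    then show ?thesis using v by (simp only: powr_add) simp
  qed
  define E where "E = v powr of_real (a - 1/2) * exp (- (2 * v))"
  have "scaled_hyp0F1 a v = of_real (2 * sqrt pi / Gamma a) * E * hyp0F1 a (v\<^sup>2)"
    by (simp add: scaled_hyp0F1_def E_def)
  moreover have "of_real a / v * scaled_hyp0F1 (a + 1) v = of_real (2 * sqrt pi / Gamma a) * E * hyp0F1 (a + 1) (v\<^sup>2)"
    using a v G unfolding scaled_hyp0F1_def G1 p1 E_def by (simp add: field_simps)
  moreover have "scaled_hyp0F1 (a + 2) v = of_real (2 * sqrt pi / Gamma a) * E * (v\<^sup>2 / of_real (a * (a + 1)) * hyp0F1 (a + 2) (v\<^sup>2))"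
    unfolding scaled_hyp0F1_def G2 p2 E_def by (simp add: mult_ac)
  moreover note hyp0F1_contiguous[OF a, of "v\<^sup>2"]
  ultimately show ?thesis by (simp only: distrib_left)
qed

text \<open>The Laplace remainder has order \<open>Re w powr (- (c + 2))\<close> and the
  normalisation multiplies it by \<open>norm w powr c\<close>. In the sector the product is of order
  \<open>1 / (norm w)^2\<close>. The rate is \<open>w = 4 * v\<close> because
  \<open>exp (2 * v * (1 - 2 * x)) = exp (2 * v) * exp (- 4 * v * x)\<close>.\<close>

lemma scaled_hyp0F1_error_base:
  fixes a d :: real
  assumes a: "a > 3/2" and d: "d > 0"
  obtains C where "\<And>v. v \<noteq> 0 \<Longrightarrow> d * norm v \<le> Re v \<Longrightarrow> norm (scaled_hyp0F1_error a v) \<le> C / (norm v)\<^sup>2"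
proof -
  define m where "m = a - 3/2"
  define c where "c = m + 1"
  have m: "m > 0" and c: "c > 0" and ac: "a = c + 1/2" and mc: "m = c - 1"
    using a by (auto simp: m_def c_def)
  define g where "g x = (if x < 1 then (1 - x) powr m else 0)" for x :: real
  have g_meas: "g \<in> borel_measurable borel" unfolding g_def by measurable
  obtain K where K: "\<And>x. x \<ge> 0 \<Longrightarrow> \<bar>g x - 1 - (- m) * x\<bar> \<le> K * x\<^sup>2"
    using truncated_power_two_term[OF m] unfolding g_def by blast
  have K0: "K \<ge> 0" using K[of 1] abs_ge_zero[of "g 1 - 1 - (- m) * 1"] by (simp del: abs_ge_zero)
  have Gc: "Gamma c > 0" "Gamma a > 0" "Gamma (2 * c) > 0" using c ac by (auto intro!: Gamma_real_pos)
  have G1: "Gamma (c + 1) = c * Gamma c" by (rule Gamma_plus1_pos[OF c])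
  have G2: "Gamma (c + 2) = (c + 1) * (c * Gamma c)"
    using c Gamma_plus1_pos[of "c + 1"] G1 by (simp add: add.assoc)
  \<comment> \<open>Legendre duplication converts the factor \<open>Gamma (2 * c)\<close> in
    \<open>Beta c c\<close> into \<open>Gamma c * Gamma (c + 1/2)\<close>, where
    \<open>c + 1/2 = a\<close>.\<close>
  have const: "2 * sqrt pi / Gamma a = 4 powr c / Gamma c * Beta (m + 1) (m + 1)"
  proof -
    have "(2::real) powr (1 - 2 * c) = 2 / 4 powr c"
      by (simp add: powr_diff powr_powr[symmetric])
    then have "Gamma c * Gamma a * 4 powr c = 2 * sqrt pi * Gamma (2 * c)"
      using Gamma_legendre_duplication_real[OF c] ac by simp
    then have "4 powr c = 2 * sqrt pi * Gamma (2 * c) / (Gamma c * Gamma a)"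
      using Gc by (simp add: field_simps)
    moreover have "Beta (m + 1) (m + 1) = Gamma c * Gamma c / Gamma (2 * c)"
      by (simp only: c_def[symmetric] Beta_def mult_2)
    ultimately show ?thesis using Gc by simp
  qed
  show thesis
  proof (rule that)
    fix v :: complex assume v: "v \<noteq> 0" and dv: "d * norm v \<le> Re v"
    have nv: "norm v > 0" using v by simp
    have Rv: "Re v > 0" using dv d nv by (meson less_le_trans mult_pos_pos)
    define w where "w = 4 * v"
    have w: "w \<noteq> 0" "Re w > 0" using v Rv by (auto simp: w_def)
    define I where "I = (\<integral>x. of_real (indicator {0..} x * x powr (c - 1) * g x) * exp (- (w * of_real x)) \<partial>lborel)"
    have "of_real (Beta (m + 1) (m + 1)) * hyp0F1 a (v\<^sup>2)
        = (\<integral>x. of_real (indicator {0..1} x * (x * (1 - x)) powr m) * exp (2 * v * of_real (1 - 2 * x)) \<partial>lborel)"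
      using hyp0F1_Poisson_integral[OF m, of v] by (simp add: m_def)
    also have "\<dots> = (\<integral>x. exp (2 * v) * (of_real (indicator {0..} x * x powr (c - 1) * g x) * exp (- (w * of_real x))) \<partial>lborel)"
    proof (intro Bochner_Integration.integral_cong refl)
      fix x :: real
      have "exp (2 * v * of_real (1 - 2 * x)) = exp (2 * v) * exp (- (w * of_real x))"
        by (simp add: exp_add[symmetric] w_def algebra_simps)
      moreover have "indicator {0..1} x * (x * (1 - x)) powr m = indicator {0..} x * x powr (c - 1) * g x"
        using m by (auto simp: g_def indicator_def powr_mult mc)
      ultimately show "of_real (indicator {0..1} x * (x * (1 - x)) powr m) * exp (2 * v * of_real (1 - 2 * x))
          = exp (2 * v) * (of_real (indicator {0..} x * x powr (c - 1) * g x) * exp (- (w * of_real x)))"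
        by (simp only: mult_ac)
    qed
    also have "\<dots> = exp (2 * v) * I" by (simp add: I_def)
    finally have BI: "of_real (Beta (m + 1) (m + 1)) * hyp0F1 a (v\<^sup>2) = exp (2 * v) * I" .
    have wp: "w powr of_real c = of_real (4 powr c) * v powr of_real c"
      using powr_times_real_left[of 4 v "of_real c"] powr_of_real[of 4 c] by (simp add: w_def)
    have N: "scaled_hyp0F1 a v = w powr of_real c / of_real (Gamma c) * I"
    proof -
      have "scaled_hyp0F1 a v = of_real (4 powr c / Gamma c) * v powr of_real c * exp (- (2 * v)) * (of_real (Beta (m + 1) (m + 1)) * hyp0F1 a (v\<^sup>2))"
        unfolding scaled_hyp0F1_def const by (simp add: ac mult_ac)
      also have "\<dots> = of_real (4 powr c / Gamma c) * v powr of_real c * (exp (- (2 * v)) * exp (2 * v)) * I"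
        unfolding BI by (simp only: mult_ac)
      also have "exp (- (2 * v)) * exp (2 * v) = 1" by (simp add: exp_add[symmetric])
      finally show ?thesis by (simp add: wp)
    qed
    have bnd: "norm (I - of_real (Gamma c) * w powr (- of_real c) - of_real (- m * Gamma (c + 1)) * w powr (- of_real (c + 1)))
        \<le> K * (Gamma (c + 2) * Re w powr (- (c + 2)))"
      unfolding I_def by (rule Laplace_two_term_bound[OF c w(2) g_meas K])
    have pw: "w powr of_real c \<noteq> 0" using w by simp
    have "scaled_hyp0F1_error a v = w powr of_real c / of_real (Gamma c) *
       (I - of_real (Gamma c) * w powr (- of_real c) - of_real (- m * Gamma (c + 1)) * w powr (- of_real (c + 1)))"
    proof -
      define P X Y where "P = w powr of_real c" and "X = w powr (- of_real c)" and "Y = w powr (- of_real (c + 1))"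
      have PX: "P * X = 1" and PY: "P * Y = 1 / w"
        using w by (simp_all add: P_def X_def Y_def powr_minus powr_add powr_diff divide_inverse)
      have G0: "complex_of_real (Gamma c) \<noteq> 0" using Gc by simp
      have "P / of_real (Gamma c) * (I - of_real (Gamma c) * X - of_real (- m * Gamma (c + 1)) * Y)
          = P / of_real (Gamma c) * I - P * X + of_real (m * c) * (P * Y)"
        using G0 unfolding G1 by (simp add: field_simps)
      also have "\<dots> = P / of_real (Gamma c) * I - (1 - of_real (m * c) / w)"
        unfolding PX PY by simp
      also have "of_real (m * c) / w = of_real ((a - 3/2) * (a - 1/2)) / (4 * v)"
        by (simp add: w_def mc ac)
      finally show ?thesis
        unfolding scaled_hyp0F1_error_def N P_def X_def Y_def by (rule sym)
    qed
    then have "norm (scaled_hyp0F1_error a v) = norm w powr c / Gamma c *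
        norm (I - of_real (Gamma c) * w powr (- of_real c) - of_real (- m * Gamma (c + 1)) * w powr (- of_real (c + 1)))"
      using Gc by (simp only: norm_mult norm_divide norm_of_real norm_powr_real_powr'[OF Reals_of_real] Re_complex_of_real abs_of_pos)
    also have "\<dots> \<le> norm w powr c / Gamma c * (K * (Gamma (c + 2) * Re w powr (- (c + 2))))"
      by (rule mult_left_mono[OF bnd]) (use Gc in simp)
    \<comment> \<open>Here the sector condition is spent: a negative power of \<open>Re w\<close> is
      traded for the same power of \<open>d * norm w\<close>.\<close>
    also have "\<dots> \<le> norm w powr c / Gamma c * (K * (Gamma (c + 2) * (d * norm w) powr (- (c + 2))))"
    proof -
      have "Re w powr (- (c + 2)) \<le> (d * norm w) powr (- (c + 2))"
        using dv d w c by (intro powr_mono2') (auto simp: w_def norm_mult)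
      then show ?thesis
        using K0 Gc c unfolding G2 by (intro mult_left_mono) auto
    qed
    also have "(d * norm w) powr (- (c + 2)) = d powr (- (c + 2)) * norm w powr (- (c + 2))"
      using d by (simp add: powr_mult)
    also have "norm w powr c / Gamma c * (K * (Gamma (c + 2) * (d powr (- (c + 2)) * norm w powr (- (c + 2)))))
       = K * ((c + 1) * c) * d powr (- (c + 2)) / (norm w)\<^sup>2"
    proof -
      have "norm w powr (- (c + 2)) = 1 / (norm w powr c * (norm w)\<^sup>2)"
        using w by (simp add: powr_minus powr_add powr_diff divide_inverse)
      then show ?thesis using Gc w unfolding G2 by simp
    qed
    also have "\<dots> = (K * ((c + 1) * c) * d powr (- (c + 2)) / 16) / (norm v)\<^sup>2"
      by (simp add: w_def norm_mult power_mult_distrib)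
    finally show "norm (scaled_hyp0F1_error a v) \<le> (K * ((c + 1) * c) * d powr (- (c + 2)) / 16) / (norm v)\<^sup>2"
      .
  qed
qed

text \<open>The terms in \<open>1 / v\<close> agree because
  \<open>(a + 1/2) * (a + 3/2) - 4 * a = (a - 3/2) * (a - 1/2)\<close>. What remains is the
  \<open>1 / v\<close> correction at \<open>a + 1\<close> multiplied by \<open>a / v\<close>, which
  is of second order, and the two given errors; \<open>norm v \<ge> 1\<close> absorbs the factor
  \<open>1 / v\<close> before the first of them.\<close>

lemma scaled_hyp0F1_error_step:
  assumes a: "a > 0" and v: "norm v \<ge> 1"
    and C1: "norm (scaled_hyp0F1_error (a + 1) v) \<le> C1 / (norm v)\<^sup>2"
    and C2: "norm (scaled_hyp0F1_error (a + 2) v) \<le> C2 / (norm v)\<^sup>2"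
  shows "norm (scaled_hyp0F1_error a v) \<le> (a * C1 + a * \<bar>(a - 1/2) * (a + 1/2)\<bar> / 4 + C2) / (norm v)\<^sup>2"
proof -
  have v0: "v \<noteq> 0" using v by auto
  have C10: "C1 \<ge> 0" using C1 v by (smt (verit) divide_neg_pos norm_ge_zero zero_less_power)
  let ?b = "of_real a * of_real ((a - 1/2) * (a + 1/2)) / 4 :: complex"
  have "scaled_hyp0F1_error a v = of_real a / v * scaled_hyp0F1_error (a + 1) v - ?b / v\<^sup>2 + scaled_hyp0F1_error (a + 2) v"
    unfolding scaled_hyp0F1_error_def scaled_hyp0F1_contiguous[OF a v0]
    using v0 by (simp add: field_simps power2_eq_square)
  then have "norm (scaled_hyp0F1_error a v) \<le> norm (of_real a / v * scaled_hyp0F1_error (a + 1) v) + norm (?b / v\<^sup>2) + norm (scaled_hyp0F1_error (a + 2) v)"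
    by (simp only:) (rule order_trans[OF norm_triangle_ineq add_right_mono[OF norm_triangle_ineq4]])
  also have "norm (of_real a / v * scaled_hyp0F1_error (a + 1) v) \<le> a * (C1 / (norm v)\<^sup>2)"
  proof -
    have "a / norm v \<le> a" using a v by (simp add: divide_le_eq mult_le_cancel_left1)
    then show ?thesis unfolding norm_mult norm_divide using a C1 by (intro mult_mono) auto
  qed
  also have "norm (?b / v\<^sup>2) = a * \<bar>(a - 1/2) * (a + 1/2)\<bar> / 4 / (norm v)\<^sup>2"
    using a by (simp only: norm_divide norm_mult norm_power norm_of_real norm_numeral abs_of_pos)
  finally show ?thesis using C2 by (simp add: add_divide_distrib)
qed

text \<open>Two descents suffice: for \<open>a > 0\<close> both \<open>a + 2\<close> and
  \<open>a + 3\<close> exceed \<open>3/2\<close>, which gives \<open>a + 1\<close>, and then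
  \<open>a + 1\<close> and \<open>a + 2\<close> give \<open>a\<close>.\<close>

lemma scaled_hyp0F1_error_bound:
  fixes a d :: real
  assumes a: "a > 0" and d: "d > 0"
  obtains C where "\<And>v. norm v \<ge> 1 \<Longrightarrow> d * norm v \<le> Re v \<Longrightarrow> norm (scaled_hyp0F1_error a v) \<le> C / (norm v)\<^sup>2"
proof -
  define P where "P a \<longleftrightarrow> (\<exists>C. \<forall>v. norm v \<ge> 1 \<longrightarrow> d * norm v \<le> Re v \<longrightarrow> norm (scaled_hyp0F1_error a v) \<le> C / (norm v)\<^sup>2)" for a
  have base: "P a" if "a > 3/2" for a
    using scaled_hyp0F1_error_base[OF that d] unfolding P_def by (metis norm_zero not_one_le_zero)
  have step: "P a" if "a > 0" "P (a + 1)" "P (a + 2)" for a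
  proof -
    obtain C1 C2 where "\<forall>v. norm v \<ge> 1 \<longrightarrow> d * norm v \<le> Re v \<longrightarrow> norm (scaled_hyp0F1_error (a + 1) v) \<le> C1 / (norm v)\<^sup>2"
      "\<forall>v. norm v \<ge> 1 \<longrightarrow> d * norm v \<le> Re v \<longrightarrow> norm (scaled_hyp0F1_error (a + 2) v) \<le> C2 / (norm v)\<^sup>2"
      using \<open>P (a + 1)\<close> \<open>P (a + 2)\<close> unfolding P_def by blast
    then show ?thesis
      unfolding P_def using scaled_hyp0F1_error_step[OF \<open>a > 0\<close>] by blast
  qed
  have "P (a + 1)" by (rule step) (use a base[of "a + 1 + 1"] base[of "a + 1 + 2"] in auto)
  then have "P a" using step[of a] a base[of "a + 2"] by auto
  then show thesis using that unfolding P_def by blast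
qed

section \<open>Gaussian integrals\<close>

text \<open>For complex \<open>c\<close> the square is not completed by a contour shift. Instead
  \<open>exp (c * x)\<close> is expanded: odd Gaussian moments vanish, and the even ones sum to the
  series of \<open>exp (c^2 / 4)\<close>.\<close>

lemma has_bochner_integral_gaussian_exp_unit:
  fixes c :: complex
  shows "has_bochner_integral lborel (\<lambda>x. exp (c * of_real x - (of_real x)\<^sup>2)) (of_real (sqrt pi) * exp (c\<^sup>2 / 4))"
proof -
  define f where "f k x = of_real (exp (- x\<^sup>2)) * ((c * of_real x) ^ k /\<^sub>R fact k)" for k and x :: real
  \<comment> \<open>From \<open>0 \<le> (\<bar>x\<bar> - norm c)^2\<close>: half of
    \<open>x^2\<close> pays for the linear exponent. The rest is written as a rescaled unit Gaussian
    so that its integrability follows by an affine substitution.\<close>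
  define W where "W x = exp ((norm c)\<^sup>2 / 2) * exp (- (0 + (1 / sqrt 2) * x)\<^sup>2)" for x :: real
  have meas: "f k \<in> borel_measurable lborel" for k unfolding f_def by measurable
  have "has_bochner_integral lborel (\<lambda>x::real. exp (- x\<^sup>2)) (sqrt pi)"
    using has_bochner_integral_even_function[OF gaussian_moment_even_pos[where k=0]] by simp
  then have "has_bochner_integral lborel (\<lambda>x::real. exp (- (0 + (1 / sqrt 2) * x)\<^sup>2)) (sqrt pi /\<^sub>R \<bar>1 / sqrt 2\<bar>)"
    by (subst (asm) lborel_has_bochner_integral_real_affine_iff[where c="1 / sqrt 2" and t=0]) auto
  then have W: "integrable lborel W"
    unfolding W_def by (auto simp: has_bochner_integral_iff)
  have sums: "(\<lambda>k. f k x) sums exp (c * of_real x - (of_real x)\<^sup>2)" for x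
  proof -
    have "(\<lambda>k. f k x) sums (of_real (exp (- x\<^sup>2)) * exp (c * of_real x))"
      unfolding f_def by (intro sums_mult exp_converges)
    also have "of_real (exp (- x\<^sup>2)) * exp (c * of_real x) = exp (c * of_real x - (of_real x)\<^sup>2)"
      by (simp add: exp_of_real[symmetric] exp_add[symmetric])
    finally show ?thesis .
  qed
  have bound: "(\<Sum>k<N. norm (f k x)) \<le> W x" for N x
  proof -
    have "norm (f k x) = exp (- x\<^sup>2) * ((norm c * \<bar>x\<bar>) ^ k / fact k)" for k
      by (simp add: f_def norm_mult norm_power divide_inverse mult.commute)
    then have "(\<Sum>k<N. norm (f k x)) = exp (- x\<^sup>2) * (\<Sum>k<N. (norm c * \<bar>x\<bar>) ^ k / fact k)"
      by (simp add: sum_distrib_left)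
    also have "\<dots> \<le> exp (- x\<^sup>2) * exp (norm c * \<bar>x\<bar>)"
      by (intro mult_left_mono exp_partial_sum_le) auto
    also have "\<dots> \<le> W x"
    proof -
      have "0 \<le> (\<bar>x\<bar> - norm c)\<^sup>2" by simp
      then have "2 * (norm c * \<bar>x\<bar>) \<le> x\<^sup>2 + (norm c)\<^sup>2" by (simp add: power2_diff mult_ac)
      then have "- x\<^sup>2 + norm c * \<bar>x\<bar> \<le> (norm c)\<^sup>2 / 2 + - (x\<^sup>2 / 2)" by linarith
      then show ?thesis by (simp add: W_def mult_exp_exp power_divide)
    qed
    finally show ?thesis .
  qed
  have int_f: "integral\<^sup>L lborel (f k) = c ^ k / fact k * of_real (\<integral>x. exp (- x\<^sup>2) * x ^ k \<partial>lborel)" for k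
  proof -
    have "f k = (\<lambda>x. c ^ k / fact k * of_real (exp (- x\<^sup>2) * x ^ k))"
      by (auto simp: f_def power_mult_distrib scaleR_conv_of_real divide_inverse mult_ac)
    then show ?thesis by (simp only: integral_mult_right_zero integral_complex_of_real)
  qed
  have even: "integral\<^sup>L lborel (f (2 * k)) = of_real (sqrt pi) * ((c\<^sup>2 / 4) ^ k /\<^sub>R fact k)" for k
  proof -
    have "(\<integral>x. exp (- x\<^sup>2) * x ^ (2 * k) \<partial>lborel) = sqrt pi * (fact (2 * k) / (4 ^ k * fact k))"
      using has_bochner_integral_even_function[OF gaussian_moment_even_pos[of k]]
      by (simp add: has_bochner_integral_iff power_mult)
    then have "integral\<^sup>L lborel (f (2 * k)) = c ^ (2 * k) / fact (2 * k) * of_real (sqrt pi * (fact (2 * k) / (4 ^ k * fact k)))"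
      by (simp only: int_f)
    also have "c ^ (2 * k) = (c\<^sup>2) ^ k" by (rule power_mult)
    finally show ?thesis by (simp add: power_divide scaleR_conv_of_real) (simp add: field_simps)
  qed
  have odd: "integral\<^sup>L lborel (f n) = 0" if "odd n" for n
  proof -
    from \<open>odd n\<close> obtain k where k: "n = 2 * k + 1" by (auto elim: oddE)
    have "(\<integral>x. exp (- x\<^sup>2) * (x::real) ^ (2 * k + 1) \<partial>lborel) = 0"
      using has_bochner_integral_odd_function[OF gaussian_moment_odd_pos[of k]]
      by (simp add: has_bochner_integral_iff)
    then show ?thesis unfolding int_f k by simp
  qed
  have S: "(\<lambda>k. integral\<^sup>L lborel (f k)) sums (\<integral>x. exp (c * of_real x - (of_real x)\<^sup>2) \<partial>lborel)"
    by (rule integral_sums_dominated[OF meas W sums bound])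
  have "(\<lambda>k. integral\<^sup>L lborel (f (2 * k))) sums (\<integral>x. exp (c * of_real x - (of_real x)\<^sup>2) \<partial>lborel)"
    using S by (subst sums_mono_reindex) (auto simp: strict_mono_def intro!: odd elim!: evenE)
  moreover have "(\<lambda>k. integral\<^sup>L lborel (f (2 * k))) sums (of_real (sqrt pi) * exp (c\<^sup>2 / 4))"
    unfolding even by (intro sums_mult exp_converges)
  ultimately have "(\<integral>x. exp (c * of_real x - (of_real x)\<^sup>2) \<partial>lborel) = of_real (sqrt pi) * exp (c\<^sup>2 / 4)"
    by (rule sums_unique2)
  moreover have "integrable lborel (\<lambda>x. exp (c * of_real x - (of_real x)\<^sup>2))"
    by (rule integrable_sums_dominated[OF meas W sums bound])
  ultimately show ?thesis by (simp add: has_bochner_integral_iff)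
qed

lemma has_bochner_integral_gaussian_exp_real:
  fixes c :: complex and t :: real
  assumes t: "t > 0"
  shows "has_bochner_integral lborel (\<lambda>x. exp (c * of_real x - of_real t * (of_real x)\<^sup>2))
    (of_real (sqrt (pi / t)) * exp (c\<^sup>2 / (4 * of_real t)))"
proof -
  define r where "r = sqrt t"
  have r: "r > 0" "r\<^sup>2 = t" using t by (auto simp: r_def)
  have "has_bochner_integral lborel (\<lambda>x. exp (c / of_real r * of_real x - (of_real x)\<^sup>2)) (of_real (sqrt pi) * exp ((c / of_real r)\<^sup>2 / 4))"
    by (rule has_bochner_integral_gaussian_exp_unit)
  then have "has_bochner_integral lborel (\<lambda>x. exp (c / of_real r * of_real (0 + r * x) - (of_real (0 + r * x))\<^sup>2))
     ((of_real (sqrt pi) * exp ((c / of_real r)\<^sup>2 / 4)) /\<^sub>R \<bar>r\<bar>)"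
    using r by (subst (asm) lborel_has_bochner_integral_real_affine_iff[where c=r and t=0]) auto
  moreover have "c / of_real r * of_real (0 + r * x) - (of_real (0 + r * x))\<^sup>2 = c * of_real x - of_real t * (of_real x)\<^sup>2" for x
    using r by (simp add: power_mult_distrib flip: of_real_power)
  moreover have "(of_real (sqrt pi) * exp ((c / of_real r)\<^sup>2 / 4)) /\<^sub>R \<bar>r\<bar> = of_real (sqrt (pi / t)) * exp (c\<^sup>2 / (4 * of_real t))"
    using r(1) unfolding r(2)[symmetric]
    by (simp add: real_sqrt_divide scaleR_conv_of_real power_divide field_simps)
  ultimately show ?thesis by simp
qed

text \<open>In coordinates the integrand is a product over \<open>Basis\<close>, and
  \<open>lborel\<close> is the image of a product measure. Three rates \<open>t\<close> occur later:
  \<open>1\<close> for the generating function, \<open>1/2\<close> for majorants, and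
  \<open>1 - s\<close> for the moments of the norm.\<close>

lemma has_bochner_integral_gaussian_exp:
  fixes c :: "'a::euclidean_space \<Rightarrow> complex" and t :: real
  assumes t: "t > 0"
  shows "has_bochner_integral lborel (\<lambda>x::'a. exp ((\<Sum>b\<in>Basis. c b * of_real (x \<bullet> b)) - of_real (t * (norm x)\<^sup>2)))
    (of_real (sqrt (pi / t)) ^ DIM('a) * exp ((\<Sum>b\<in>Basis. (c b)\<^sup>2) / (4 * of_real t)))"
proof -
  interpret product_sigma_finite "\<lambda>_::'a. lborel :: real measure" by standard
  let ?P = "\<Pi>\<^sub>M b\<in>(Basis::'a set). (lborel :: real measure)"
  let ?T = "\<lambda>f::'a \<Rightarrow> real. \<Sum>b\<in>Basis. f b *\<^sub>R b"
  let ?h = "\<lambda>b y. exp (c b * of_real y - of_real t * (of_real y)\<^sup>2)"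
  define F where "F x = exp ((\<Sum>b\<in>Basis. c b * of_real (x \<bullet> b)) - of_real (t * (norm x)\<^sup>2))" for x :: 'a
  have T: "?T \<in> ?P \<rightarrow>\<^sub>M borel" by measurable
  have F: "F \<in> borel_measurable borel" unfolding F_def by measurable
  have FT: "F (?T f) = (\<Prod>b\<in>Basis. ?h b (f b))" for f
  proof -
    have "(norm (?T f))\<^sup>2 = (\<Sum>b\<in>Basis. (f b)\<^sup>2)"
      by (subst euclidean_inner[of "?T f" "?T f", folded power2_norm_eq_inner]) (simp add: inner_sum_left_Basis power2_eq_square)
    then show ?thesis
      by (simp add: F_def exp_sum[symmetric] inner_sum_left_Basis sum_subtractf sum_distrib_left)
  qed
  have hi: "integrable lborel (?h b)" "integral\<^sup>L lborel (?h b) = of_real (sqrt (pi / t)) * exp ((c b)\<^sup>2 / (4 * of_real t))" for b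
    using has_bochner_integral_gaussian_exp_real[OF t, of "c b"] by (auto simp: has_bochner_integral_iff)
  have "integrable ?P (\<lambda>f. F (?T f))"
    unfolding FT by (intro product_integrable_prod hi finite_Basis)
  then have "integrable (distr ?P borel ?T) F"
    by (subst integrable_distr_eq[OF T F])
  moreover have "integral\<^sup>L (distr ?P borel ?T) F = (\<Prod>b\<in>Basis. of_real (sqrt (pi / t)) * exp ((c b)\<^sup>2 / (4 * of_real t)))"
    unfolding integral_distr[OF T F] FT by (subst product_integral_prod[OF finite_Basis hi(1)]) (simp only: hi(2))
  moreover have "(\<Prod>b\<in>Basis. of_real (sqrt (pi / t)) * exp ((c b)\<^sup>2 / (4 * of_real t)))
      = of_real (sqrt (pi / t)) ^ DIM('a) * exp ((\<Sum>b\<in>Basis. (c b)\<^sup>2) / (4 * of_real t))"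
    by (simp add: prod.distrib exp_sum sum_divide_distrib)
  ultimately show ?thesis
    unfolding F_def[symmetric] lborel_eq[symmetric] by (simp add: has_bochner_integral_iff)
qed

text \<open>The common majorant for Gaussian moments of \<open>hdot\<close>: the form grows linearly
  in \<open>norm x\<close>, so its exponential has this shape, and half of the quadratic term beats
  the linear one.\<close>

lemma integrable_exp_norm_gaussian:
  "integrable lborel (\<lambda>x::'a::euclidean_space. exp (R * norm x - (norm x)\<^sup>2))"
proof (rule Bochner_Integration.integrable_bound)
  have "integrable lborel (\<lambda>x::'a. norm (exp ((\<Sum>b\<in>Basis. 0 * of_real (x \<bullet> b)) - complex_of_real (1/2 * (norm x)\<^sup>2))))"
    using has_bochner_integral_gaussian_exp[of "1/2" "\<lambda>_::'a. 0"]
    by (intro integrable_norm) (simp add: has_bochner_integral_iff)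
  then show "integrable lborel (\<lambda>x::'a. exp (R\<^sup>2 / 2) * exp (- ((norm x)\<^sup>2 / 2)))"
    by (intro integrable_mult_right) simp
  show "AE x::'a in lborel. norm (exp (R * norm x - (norm x)\<^sup>2)) \<le> norm (exp (R\<^sup>2 / 2) * exp (- ((norm x)\<^sup>2 / 2)))"
  proof (rule AE_I2)
    fix x :: 'a
    have "0 \<le> (norm x - R)\<^sup>2" by simp
    then have "2 * (R * norm x) \<le> (norm x)\<^sup>2 + R\<^sup>2" by (simp add: power2_diff mult_ac)
    then have "R * norm x - (norm x)\<^sup>2 \<le> R\<^sup>2 / 2 + - ((norm x)\<^sup>2 / 2)" by linarith
    then show "norm (exp (R * norm x - (norm x)\<^sup>2)) \<le> norm (exp (R\<^sup>2 / 2) * exp (- ((norm x)\<^sup>2 / 2)))"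
      by (simp add: mult_exp_exp)
  qed
qed simp

text \<open>Coefficient extraction: integrate \<open>exp (s * f x)\<close> termwise for
  \<open>0 < s < r\<close> and compare with the known series by \<open>powser_coeff_eq_0\<close>.
  The weight \<open>g\<close> may itself carry another exponential or power, which is what allows
  two variables to be treated in turn.\<close>

lemma
  fixes f g :: "'a \<Rightarrow> complex" and \<alpha> :: "nat \<Rightarrow> complex"
  assumes [measurable]: "f \<in> borel_measurable M" "g \<in> borel_measurable M" and w: "integrable M w" and r: "r > 0"
    and bound: "\<And>x. x \<in> space M \<Longrightarrow> exp (r * norm (f x)) * norm (g x) \<le> w x"
    and gen: "\<And>s. 0 < s \<Longrightarrow> s < r \<Longrightarrow> (\<lambda>l. \<alpha> l * of_real s ^ l) sums (\<integral>x. exp (of_real s * f x) * g x \<partial>M)"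
  shows integrable_moment_of_exp: "integrable M (\<lambda>x. f x ^ l * g x)"
    and moment_of_exp: "(\<integral>x. f x ^ l * g x \<partial>M) = fact l * \<alpha> l"
proof -
  define h where "h s l x = ((of_real s * f x) ^ l /\<^sub>R fact l) * g x" for s :: real and l x
  have meas: "h s l \<in> borel_measurable M" for s l unfolding h_def by measurable
  have sums: "(\<lambda>l. h s l x) sums (exp (of_real s * f x) * g x)" for s x
    unfolding h_def by (intro sums_mult2 exp_converges)
  have hb: "(\<Sum>l<N. norm (h s l x)) \<le> w x" if "x \<in> space M" "0 < s" "s < r" for s x N
  proof -
    have "norm (h s l x) = (s * norm (f x)) ^ l / fact l * norm (g x)" for l
      using that by (simp add: h_def norm_mult norm_power divide_inverse mult.commute)
    then have "(\<Sum>l<N. norm (h s l x)) = (\<Sum>l<N. (s * norm (f x)) ^ l / fact l) * norm (g x)"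
      by (simp add: sum_distrib_right)
    also have "\<dots> \<le> exp (s * norm (f x)) * norm (g x)"
      using that by (intro mult_right_mono exp_partial_sum_le) auto
    also have "\<dots> \<le> exp (r * norm (f x)) * norm (g x)"
      using that by (intro mult_right_mono) (auto intro: mult_right_mono)
    also have "\<dots> \<le> w x" by (rule bound[OF that(1)])
    finally show ?thesis .
  qed
  have h_eq: "h s l = (\<lambda>x. of_real s ^ l / fact l * (f x ^ l * g x))" for s l
    by (auto simp: h_def power_mult_distrib scaleR_conv_of_real divide_inverse mult_ac)
  show "integrable M (\<lambda>x. f x ^ l * g x)"
  proof -
    \<comment> \<open>Each term of the dominated series is integrable; at \<open>s = r/2\<close> its
      scalar factor is nonzero and can be divided out.\<close>
    have "integrable M (h (r/2) l)"
      by (rule integrable_sums_dominated_term[OF meas w sums hb]) (use r in auto)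
    then have "integrable M (\<lambda>x. fact l / of_real (r/2) ^ l * h (r/2) l x)" by (rule integrable_mult_right)
    then show ?thesis unfolding h_eq using r by simp
  qed
  have "(\<lambda>l. ((\<integral>x. f x ^ l * g x \<partial>M) / fact l - \<alpha> l) * of_real s ^ l) sums 0" if s: "0 < s" "s < r" for s
  proof -
    have "(\<lambda>l. integral\<^sup>L M (h s l)) sums (\<integral>x. exp (of_real s * f x) * g x \<partial>M)"
      by (rule integral_sums_dominated[OF meas w sums hb]) (use s in auto)
    moreover have "integral\<^sup>L M (h s l) = (\<integral>x. f x ^ l * g x \<partial>M) / fact l * of_real s ^ l" for l
      unfolding h_eq by simp
    ultimately show ?thesis
      using sums_diff[OF _ gen[OF s]] by (simp only: left_diff_distrib) fastforce
  qed
  from powser_coeff_eq_0[OF r this, where m=l] show "(\<integral>x. f x ^ l * g x \<partial>M) = fact l * \<alpha> l"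
    by (simp add: field_simps)
qed

section \<open>Polar decomposition of Lebesgue measure\<close>

text \<open>Extending the sphere measure by zero to a measure on the whole space gives it the Borel
  sigma-algebra, so that it can be a factor of a product measure.\<close>

definition sphere_distr :: "'a::euclidean_space measure" where
  "sphere_distr = distr (uniform_measure lborel (ball 0 1)) borel sgn"

lemma emeasure_lborel_unit_ball:
  "emeasure lborel (ball 0 1 :: 'a::euclidean_space set) \<noteq> 0" "emeasure lborel (ball 0 1 :: 'a set) \<noteq> \<infinity>"
proof -
  have "\<not> negligible (ball 0 1 :: 'a set)"
    by (intro open_not_negligible) auto
  then show "emeasure lborel (ball 0 1 :: 'a set) \<noteq> 0"
    by (simp add: negligible_iff_null_sets null_sets_def)
  show "emeasure lborel (ball 0 1 :: 'a set) \<noteq> \<infinity>"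
    using emeasure_lborel_ball_finite[of "0::'a" 1] by auto
qed

lemma sgn_borel_measurable [measurable]: "(sgn :: 'a::euclidean_space \<Rightarrow> 'a) \<in> borel_measurable borel"
  unfolding sgn_div_norm by measurable

lemma prob_space_sphere_distr: "prob_space (sphere_distr :: 'a::euclidean_space measure)"
proof -
  interpret U: prob_space "uniform_measure lborel (ball 0 1 :: 'a set)"
    by (intro prob_space_uniform_measure emeasure_lborel_unit_ball)
  show ?thesis unfolding sphere_distr_def by (rule U.prob_space_distr) simp
qed

lemma sets_sphere_distr [measurable_cong, simp]: "sets sphere_distr = sets borel"
  and space_sphere_distr [simp]: "space sphere_distr = UNIV"
  by (simp_all add: sphere_distr_def)

lemma emeasure_sphere_distr:
  fixes B :: "'a::euclidean_space set"
  assumes "B \<in> sets borel"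
  shows "emeasure sphere_distr B = emeasure lborel (sgn -` B \<inter> ball 0 1) / emeasure lborel (ball 0 1 :: 'a set)"
proof -
  have "sgn -` B \<in> sets borel" using measurable_sets_borel[OF sgn_borel_measurable assms] .
  then show ?thesis
    using assms by (simp add: sphere_distr_def emeasure_distr Int_commute)
qed

lemma AE_sphere_distr: "AE x in (sphere_distr :: 'a::euclidean_space measure). x \<in> sphere 0 1"
proof -
  have "AE x in lborel. (x::'a) \<noteq> 0" by (rule AE_lborel_singleton)
  then have "AE x in lborel. sgn (x::'a) \<in> sphere 0 1" by eventually_elim (simp add: norm_sgn)
  then have "AE x in uniform_measure lborel (ball 0 1). sgn (x::'a) \<in> sphere 0 1"
    using emeasure_lborel_unit_ball[where 'a='a]
    by (intro AE_uniform_measureI) (auto elim: eventually_mono)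
  then show ?thesis unfolding sphere_distr_def by (subst AE_distr_iff) auto
qed

lemma integral_sphere_measure:
  fixes f :: "'a::euclidean_space \<Rightarrow> 'b::{banach, second_countable_topology}"
  assumes [measurable]: "f \<in> borel_measurable borel"
  shows "integral\<^sup>L sphere_measure f = integral\<^sup>L sphere_distr f"
proof -
  have "integral\<^sup>L sphere_measure f = (\<integral>x. indicator (sphere 0 1) x *\<^sub>R f x \<partial>sphere_distr)"
    unfolding sphere_measure_def sphere_distr_def[symmetric]
    by (rule integral_restrict_space) simp
  also have "\<dots> = integral\<^sup>L sphere_distr f"
  proof (rule integral_cong_AE)
    have "sphere 0 1 \<in> sets (borel :: 'a measure)" by simp
    then have "(\<lambda>x. indicator (sphere 0 1) x *\<^sub>R f x) \<in> borel_measurable borel"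
      by (intro borel_measurable_scaleR borel_measurable_indicator assms)
    with assms show "(\<lambda>x. indicator (sphere 0 1) x *\<^sub>R f x) \<in> borel_measurable sphere_distr"
      and "f \<in> borel_measurable sphere_distr"
      by (simp_all only: measurable_cong_sets[OF sets_sphere_distr refl])
    show "AE x in sphere_distr. indicator (sphere 0 1) x *\<^sub>R f x = f x"
      using AE_sphere_distr by (rule eventually_mono) simp
  qed
  finally show ?thesis .
qed

lemma emeasure_cone_ball:
  fixes B :: "'a::euclidean_space set"
  assumes B: "B \<in> sets borel" and r: "r > 0"
  shows "emeasure lborel (sgn -` B \<inter> ball 0 r) = ennreal (r ^ DIM('a)) * emeasure lborel (sgn -` B \<inter> ball 0 1)"
proof -
  have S: "sgn -` B \<in> sets borel" using measurable_sets_borel[OF sgn_borel_measurable B] .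
  have eq: "(\<lambda>x::'a. 0 + r *\<^sub>R x) -` (sgn -` B \<inter> ball 0 r) = sgn -` B \<inter> ball 0 1"
    using r by (auto simp: sgn_scaleR)
  have "emeasure lborel (sgn -` B \<inter> ball 0 r)
      = emeasure (density (distr lborel borel (\<lambda>x. 0 + r *\<^sub>R x)) (\<lambda>_. ennreal (\<bar>r\<bar> ^ DIM('a)))) (sgn -` B \<inter> ball 0 r)"
    by (subst lborel_affine[of r 0, symmetric]) (use r in auto)
  also have "\<dots> = ennreal (r ^ DIM('a)) * emeasure (distr lborel borel (\<lambda>x. 0 + r *\<^sub>R x)) (sgn -` B \<inter> ball 0 r)"
    using S r by (simp add: emeasure_density_const)
  also have "emeasure (distr lborel borel (\<lambda>x. 0 + r *\<^sub>R x)) (sgn -` B \<inter> ball 0 r)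
      = emeasure lborel ((\<lambda>x::'a. 0 + r *\<^sub>R x) -` (sgn -` B \<inter> ball 0 r))"
    using S by (subst emeasure_distr) auto
  finally show ?thesis unfolding eq .
qed

lemma sigma_finite_distr_norm: "sigma_finite_measure (distr lborel borel (norm :: 'a::euclidean_space \<Rightarrow> real))"
proof -
  have "emeasure (distr lborel borel (norm :: 'a \<Rightarrow> real)) {..<real n} \<noteq> \<infinity>" for n
  proof -
    have "norm -` {..<real n} = (ball 0 (real n) :: 'a set)" by auto
    then show ?thesis using emeasure_lborel_ball_finite[of "0::'a" "real n"] by (simp add: emeasure_distr)
  qed
  moreover have "(\<Union>n. {..<real n}) = UNIV" using reals_Archimedean2 by auto
  ultimately show ?thesis
    by (intro sigma_finite_measure.intro exI[of _ "range (\<lambda>n. {..<real n})"]) auto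
qed

text \<open>Radius and direction are independent under Lebesgue measure. The radial factor is kept
  as the image of \<open>lborel\<close> under \<open>norm\<close>; its density is never computed,
  because radial integrals are pulled back to the whole space and evaluated as Gaussian integrals
  there.\<close>

lemma polar_decomposition:
  "distr lborel borel (norm :: 'a \<Rightarrow> real) \<Otimes>\<^sub>M sphere_distr
    = distr lborel (borel \<Otimes>\<^sub>M borel) (\<lambda>x::'a::euclidean_space. (norm x, sgn x))"
proof (rule pair_measure_eqI)
  show "sigma_finite_measure (distr lborel borel (norm :: 'a \<Rightarrow> real))" by (rule sigma_finite_distr_norm)
  show "sigma_finite_measure (sphere_distr :: 'a measure)"
    using prob_space_sphere_distr prob_space_imp_sigma_finite by blast
  show "sets (distr lborel borel (norm :: 'a \<Rightarrow> real) \<Otimes>\<^sub>M sphere_distr)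
      = sets (distr lborel (borel \<Otimes>\<^sub>M borel) (\<lambda>x::'a. (norm x, sgn x)))"
    by (simp cong: sets_pair_measure_cong)
next
  fix A :: "real set" and B :: "'a set"
  assume "A \<in> sets (distr lborel borel (norm :: 'a \<Rightarrow> real))" "B \<in> sets sphere_distr"
  then have A: "A \<in> sets borel" and B: "B \<in> sets borel" by auto
  have S[measurable]: "sgn -` B \<in> sets borel" using measurable_sets_borel[OF sgn_borel_measurable B] .
  \<comment> \<open>For fixed \<open>B\<close>, \<open>N\<close> is the distribution of the radius
    on the cone over \<open>B\<close>, and \<open>R\<close> that on the whole space scaled by the
    mass of \<open>B\<close>. They need only be compared on the half-lines \<open>{..<r}\<close>,
    where \<open>emeasure_cone_ball\<close> applies.\<close>
  define N where "N = distr (density lborel (indicator (sgn -` B))) borel (norm :: 'a \<Rightarrow> real)"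
  define R where "R = scale_measure (emeasure sphere_distr B) (distr lborel borel (norm :: 'a \<Rightarrow> real))"
  have N_eq: "emeasure N X = emeasure lborel (sgn -` B \<inter> norm -` X)" if "X \<in> sets borel" for X
  proof -
    have "(norm :: 'a \<Rightarrow> real) -` X \<in> sets borel" using measurable_sets_borel[of norm borel X] that by simp
    then show ?thesis
      unfolding N_def using that S
      by (subst emeasure_distr) (auto simp: emeasure_restricted)
  qed
  have "N = R"
  proof (rule measure_eqI_generator_eq[where E="range lessThan" and \<Omega>=UNIV and A="\<lambda>n. {..<real n}"])
    show "Int_stable (range lessThan :: real set set)"
      by (auto simp: Int_stable_def greaterThan_Int_greaterThan lessThan_Int_lessThan)
    show "sets N = sigma_sets UNIV (range lessThan)" "sets R = sigma_sets UNIV (range lessThan)"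
      unfolding N_def R_def by (simp_all add: borel_Iio)
    show "(\<Union>i. {..<real i}) = UNIV" using reals_Archimedean2 by auto
    fix X assume "X \<in> range (lessThan :: real \<Rightarrow> real set)"
    then obtain r where X: "X = {..<r}" by auto
    have bl: "norm -` {..<r} = (ball 0 r :: 'a set)" by auto
    show "emeasure N X = emeasure R X"
    proof (cases "r > 0")
      case True
      have "emeasure R X = emeasure sphere_distr B * emeasure lborel (ball 0 r :: 'a set)"
        unfolding R_def X by (simp add: emeasure_distr bl)
      also have "emeasure lborel (ball 0 r :: 'a set) = ennreal (r ^ DIM('a)) * emeasure lborel (ball 0 1 :: 'a set)"
        using emeasure_cone_ball[of "UNIV :: 'a set" r] True by simp
      also have "emeasure sphere_distr B * \<dots> = ennreal (r ^ DIM('a)) * (emeasure lborel (sgn -` B \<inter> ball 0 1) / emeasure lborel (ball 0 1 :: 'a set) * emeasure lborel (ball 0 1 :: 'a set))"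
        unfolding emeasure_sphere_distr[OF B] by (simp only: mult_ac)
      \<comment> \<open>Cancelling in \<open>ennreal\<close> uses that the unit ball has measure
        neither 0 nor infinite.\<close>
      also have "emeasure lborel (sgn -` B \<inter> ball 0 1) / emeasure lborel (ball 0 1 :: 'a set) * emeasure lborel (ball 0 1 :: 'a set) = emeasure lborel (sgn -` B \<inter> ball 0 1)"
        by (subst mult.commute, subst ennreal_times_divide, subst mult.commute, rule ennreal_mult_divide_eq)
          (use emeasure_lborel_unit_ball[where 'a='a] in auto)
      also have "ennreal (r ^ DIM('a)) * \<dots> = emeasure lborel (sgn -` B \<inter> ball 0 r)"
        by (rule emeasure_cone_ball[OF B True, symmetric])
      also have "\<dots> = emeasure N X" unfolding X by (subst N_eq) (auto simp: bl)
      finally show ?thesis ..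
    next
      case False
      then have "norm -` {..<r} = ({} :: 'a set)" unfolding bl by simp
      then show ?thesis
        unfolding X using N_eq[of "{..<r}"] by (simp add: R_def emeasure_distr)
    qed
  next
    show "emeasure N {..<real n} \<noteq> \<infinity>" for n
    proof -
      have "norm -` {..<real n} = (ball 0 (real n) :: 'a set)" by auto
      then have "emeasure N {..<real n} \<le> emeasure lborel (ball 0 (real n) :: 'a set)"
        by (subst N_eq) (auto intro!: emeasure_mono)
      then show ?thesis using emeasure_lborel_ball_finite[of "0::'a" "real n"] by auto
    qed
  qed auto
  then have "emeasure R A = emeasure N A" by simp
  also have "emeasure N A = emeasure (distr lborel (borel \<Otimes>\<^sub>M borel) (\<lambda>x::'a. (norm x, sgn x))) (A \<times> B)"
    using A B unfolding N_eq[OF A] by (subst emeasure_distr) (auto intro!: arg_cong[where f="emeasure lborel"])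
  finally show "emeasure (distr lborel borel (norm :: 'a \<Rightarrow> real)) A * emeasure sphere_distr B
      = emeasure (distr lborel (borel \<Otimes>\<^sub>M borel) (\<lambda>x::'a. (norm x, sgn x))) (A \<times> B)"
    unfolding R_def by (simp add: mult.commute)
qed

lemma polar_integral:
  fixes \<rho> :: "real \<Rightarrow> complex" and \<phi> :: "'a::euclidean_space \<Rightarrow> complex"
  assumes [measurable]: "\<rho> \<in> borel_measurable borel" "\<phi> \<in> borel_measurable borel"
    and int: "integrable lborel (\<lambda>x. \<rho> (norm x) * \<phi> (sgn x))"
  shows "(\<integral>x. \<rho> (norm x) * \<phi> (sgn x) \<partial>lborel) = (\<integral>x. \<rho> (norm (x::'a)) \<partial>lborel) * integral\<^sup>L sphere_measure \<phi>"
proof -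
  let ?R = "distr lborel borel (norm :: 'a \<Rightarrow> real)"
  interpret R: sigma_finite_measure ?R by (rule sigma_finite_distr_norm)
  interpret S: prob_space "sphere_distr :: 'a measure" by (rule prob_space_sphere_distr)
  interpret P: pair_sigma_finite ?R "sphere_distr :: 'a measure" ..
  have m: "(\<lambda>(r, y). \<rho> r * \<phi> y) \<in> borel_measurable (borel \<Otimes>\<^sub>M borel)" by measurable
  have T: "(\<lambda>x::'a. (norm x, sgn x)) \<in> lborel \<rightarrow>\<^sub>M borel \<Otimes>\<^sub>M borel" by measurable
  have "integrable (?R \<Otimes>\<^sub>M sphere_distr) (\<lambda>(r, y). \<rho> r * \<phi> y)"
    unfolding polar_decomposition by (subst integrable_distr_eq[OF T m]) (simp add: int)
  from P.integral_fst'[OF this]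
  have "(\<integral>r. \<integral>y. \<rho> r * \<phi> y \<partial>sphere_distr \<partial>?R) = integral\<^sup>L (?R \<Otimes>\<^sub>M sphere_distr) (\<lambda>(r, y). \<rho> r * \<phi> y)"
    by simp
  also have "\<dots> = (\<integral>x. \<rho> (norm x) * \<phi> (sgn x) \<partial>lborel)"
    unfolding polar_decomposition by (subst integral_distr[OF T m]) simp
  finally have "(\<integral>x. \<rho> (norm x) * \<phi> (sgn x) \<partial>lborel) = (\<integral>r. \<rho> r \<partial>?R) * integral\<^sup>L sphere_distr \<phi>"
    by simp
  then show ?thesis by (simp add: integral_distr integral_sphere_measure)
qed

section \<open>Moments of the Hermitian form on the sphere\<close>

lemma sum_Basis_vec:
  fixes f :: "'a::euclidean_space ^ 'n::finite \<Rightarrow> 'b::comm_monoid_add"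
  shows "(\<Sum>b\<in>Basis. f b) = (\<Sum>i\<in>UNIV. \<Sum>u\<in>Basis. f (axis i u))"
proof -
  have B: "Basis = (\<lambda>(i, u). axis i u :: 'a ^ 'n) ` (UNIV \<times> Basis)"
    by (auto simp: Basis_vec_def)
  have inj: "inj_on (\<lambda>(i, u). axis i u :: 'a ^ 'n) (UNIV \<times> Basis)"
    by (auto simp: inj_on_def axis_eq_axis nonzero_Basis)
  show ?thesis
    unfolding B sum.reindex[OF inj] by (simp add: sum.cartesian_product split_def)
qed

lemma hdot_borel_measurable [measurable]:
  "(\<lambda>x. hdot x w) \<in> borel_measurable borel" "(\<lambda>x. hdot z x) \<in> borel_measurable borel"
  unfolding hdot_def by (intro borel_measurable_continuous_onI continuous_intros)+

lemma norm_hdot_le: "norm (hdot x w) \<le> norm x * norm w"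
proof -
  have "norm (hdot x w) \<le> (\<Sum>j\<in>UNIV. norm (x $ j) * norm (w $ j))"
    unfolding hdot_def by (rule order_trans[OF norm_sum]) (simp add: norm_mult)
  also have "\<dots> \<le> norm x * norm w"
    unfolding norm_vec_def using L2_set_mult_ineq[of "\<lambda>j. norm (x $ j)" "\<lambda>j. norm (w $ j)" UNIV] by simp
  finally show ?thesis .
qed

lemma cnj_hdot: "cnj (hdot x z) = hdot z x"
  by (simp add: hdot_def mult.commute)

lemma hdot_scaleR: "hdot (r *\<^sub>R x) w = of_real r * hdot x w" "hdot z (r *\<^sub>R x) = of_real r * hdot z x"
  by (simp_all add: hdot_def scaleR_conv_of_real[symmetric] scaleR_sum_right)

lemma hdot_self: "hdot z z = of_real ((norm z)\<^sup>2)"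
  by (simp add: hdot_def norm_vec_def L2_set_def sum_nonneg complex_norm_square[symmetric] flip: of_real_power)

text \<open>\<open>hdot x w\<close> is linear and \<open>hdot z x\<close> antilinear in
  \<open>x\<close>, so \<open>L\<close> is only real-linear. This is enough, because the Gaussian
  integral sees just its values on the real \<open>Basis\<close>. Each complex coordinate
  contributes two factors \<open>sqrt pi\<close>.\<close>

lemma integral_gaussian_hdot:
  fixes w z :: "complex ^ 'n::finite" and s t :: complex
  shows "(\<integral>x. exp (s * hdot x w + t * hdot z x) * of_real (exp (- (norm x)\<^sup>2)) \<partial>lborel)
    = of_real (pi ^ CARD('n)) * exp (s * t * hdot z w)"
proof -
  define L where "L x = s * hdot x w + t * hdot z x" for x :: "complex ^ 'n"
  have lin: "linear L"
  proof (rule linearI)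
    show "L (x + y) = L x + L y" for x y
      by (simp add: L_def hdot_def algebra_simps sum.distrib)
    show "L (r *\<^sub>R x) = r *\<^sub>R L x" for r x
      by (simp add: L_def hdot_scaleR scaleR_conv_of_real[where 'a=complex] algebra_simps)
  qed
  have L_eq: "L x = (\<Sum>b\<in>Basis. L b * of_real (x \<bullet> b))" for x
  proof -
    have "L x = L (\<Sum>b\<in>Basis. (x \<bullet> b) *\<^sub>R b)" by (simp add: euclidean_representation)
    also have "\<dots> = (\<Sum>b\<in>Basis. L b * of_real (x \<bullet> b))"
      by (simp add: linear_sum[OF lin] linear_scale[OF lin] scaleR_conv_of_real[where 'a=complex] mult.commute)
    finally show ?thesis .
  qed
  have ax: "hdot (axis i u) w = u * cnj (w $ i)" "hdot z (axis i u) = z $ i * cnj u" for i u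
    by (simp_all add: hdot_def axis_def if_distrib[of "\<lambda>y. y * _"] if_distrib[of cnj] if_distrib[of "(*) _"] cong: if_cong)
  \<comment> \<open>With \<open>A = s * cnj (w $ i)\<close> and \<open>B = t * z $ i\<close>,
    \<open>L\<close> takes the values \<open>A + B\<close> and \<open>\<i> * (A - B)\<close> at the
    two basis vectors of coordinate \<open>i\<close>. Their squares add up to
    \<open>4 * A * B\<close>.\<close>
  have sq: "(\<Sum>b\<in>Basis. (L b)\<^sup>2) = 4 * (s * t * hdot z w)"
  proof -
    have "(\<Sum>u\<in>Basis. (L (axis i u))\<^sup>2) = 4 * (s * t * (z $ i * cnj (w $ i)))" for i
      by (simp add: L_def ax Basis_complex_def power2_eq_square algebra_simps)
    then show ?thesis by (simp add: sum_Basis_vec hdot_def sum_distrib_left)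
  qed
  have "exp (L x) * of_real (exp (- (norm x)\<^sup>2)) = exp ((\<Sum>b\<in>Basis. L b * of_real (x \<bullet> b)) - of_real (1 * (norm x)\<^sup>2))" for x
    unfolding L_eq[symmetric] by (simp add: exp_diff exp_minus divide_inverse exp_of_real[symmetric])
  then have "(\<integral>x. exp (L x) * of_real (exp (- (norm x)\<^sup>2)) \<partial>lborel)
      = of_real (sqrt (pi / 1)) ^ DIM(complex ^ 'n) * exp ((\<Sum>b\<in>Basis. (L b)\<^sup>2) / (4 * of_real 1))"
    using has_bochner_integral_gaussian_exp[of 1 L] by (simp only: has_bochner_integral_iff zero_less_one)
  also have "\<dots> = of_real (pi ^ CARD('n)) * exp (s * t * hdot z w)"
    by (simp add: sq power_mult mult.commute[of _ 2] flip: of_real_power)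
  finally show ?thesis by (simp only: L_def)
qed

lemma exp_sums_power:
  fixes y s :: complex
  shows "(\<lambda>l. y ^ l / fact l * s ^ l) sums exp (s * y)"
  using exp_converges[of "s * y"] by (simp add: power_mult_distrib scaleR_conv_of_real divide_inverse mult_ac)

lemma power_le_fact_exp:
  fixes y :: real
  assumes "y \<ge> 0"
  shows "y ^ l \<le> fact l * exp y"
proof -
  have "y ^ l / fact l \<le> (\<Sum>k<Suc l. y ^ k / fact k)"
    by (rule member_le_sum) (use assms in auto)
  also have "\<dots> \<le> exp y" by (rule exp_partial_sum_le[OF assms])
  finally show ?thesis by (simp add: field_simps)
qed

text \<open>The generating function depends on \<open>s\<close> and \<open>t\<close> only through
  \<open>s * t\<close>, hence the orthogonality for \<open>l \<noteq> m\<close>. Coefficients in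
  \<open>s\<close> are taken with \<open>t\<close> frozen in \<open>(0,1)\<close>, then those in
  \<open>t\<close>.\<close>

lemma integral_gaussian_hdot_moment:
  fixes w z :: "complex ^ 'n::finite"
  shows "integrable lborel (\<lambda>x. hdot x w ^ l * hdot z x ^ m * of_real (exp (- (norm x)\<^sup>2)))"
    and "(\<integral>x. hdot x w ^ l * hdot z x ^ m * of_real (exp (- (norm x)\<^sup>2)) \<partial>lborel)
      = (if l = m then of_real (pi ^ CARD('n)) * fact l * hdot z w ^ l else 0)"
proof -
  let ?e = "\<lambda>x::complex ^ 'n. complex_of_real (exp (- (norm x)\<^sup>2))"
  let ?R = "norm w + norm z"
  let ?W = "\<lambda>x::complex ^ 'n. exp (?R * norm x - (norm x)\<^sup>2)"
  have W: "integrable lborel ?W" by (rule integrable_exp_norm_gaussian)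
  have A: "norm (hdot x w) \<le> norm w * norm x" and B: "norm (hdot z x) \<le> norm z * norm x" for x
    using norm_hdot_le[of x w] norm_hdot_le[of z x] by (auto simp: mult.commute)
  have We: "?W x = exp (norm w * norm x) * exp (norm z * norm x) * exp (- (norm x)\<^sup>2)" for x
    by (simp add: mult_exp_exp algebra_simps)
  have mA: "(\<lambda>x. hdot x w) \<in> borel_measurable lborel"
    and mB: "(\<lambda>x. hdot z x) \<in> borel_measurable lborel"
    by (simp_all add: hdot_borel_measurable)
  have me: "?e \<in> borel_measurable lborel" by measurable
  have mE: "(\<lambda>x. exp (of_real t * hdot z x) * ?e x) \<in> borel_measurable lborel" for t :: real
    by (intro borel_measurable_times me measurable_compose[OF borel_measurable_times[OF borel_measurable_const mB]] borel_measurable_exp)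
  have m1: "(\<integral>x. hdot x w ^ l * (exp (of_real t * hdot z x) * ?e x) \<partial>lborel)
      = of_real (pi ^ CARD('n)) * (of_real t * hdot z w) ^ l" if t: "0 < t" "t < 1" for t :: real
  proof -
    have "(\<integral>x. hdot x w ^ l * (exp (of_real t * hdot z x) * ?e x) \<partial>lborel)
        = fact l * (of_real (pi ^ CARD('n)) * ((of_real t * hdot z w) ^ l / fact l))"
    proof (rule moment_of_exp[OF mA mE W, where r=1])
      fix x :: "complex ^ 'n"
      have "norm (exp (of_real t * hdot z x)) \<le> exp (norm z * norm x)"
      proof -
        have "norm (exp (of_real t * hdot z x)) \<le> exp (norm (of_real t * hdot z x))" by (rule norm_exp)
        also have "norm (of_real t * hdot z x) \<le> 1 * (norm z * norm x)"
          unfolding norm_mult using t B[of x] by (intro mult_mono) auto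
        finally show ?thesis by simp
      qed
      then have "exp (1 * norm (hdot x w)) * (norm (exp (of_real t * hdot z x)) * exp (- (norm x)\<^sup>2))
          \<le> exp (norm w * norm x) * (exp (norm z * norm x) * exp (- (norm x)\<^sup>2))"
        using A[of x] by (intro mult_mono) auto
      then show "exp (1 * norm (hdot x w)) * norm (exp (of_real t * hdot z x) * ?e x) \<le> ?W x"
        unfolding We by (simp add: norm_mult mult.assoc)
    next
      fix s :: real assume "0 < s" "s < 1"
      have "(\<integral>x. exp (of_real s * hdot x w) * (exp (of_real t * hdot z x) * ?e x) \<partial>lborel)
          = of_real (pi ^ CARD('n)) * exp (of_real s * of_real t * hdot z w)"
        unfolding integral_gaussian_hdot[symmetric] by (simp add: exp_add mult.assoc)
      moreover have "(\<lambda>l. of_real (pi ^ CARD('n)) * ((of_real t * hdot z w) ^ l / fact l * of_real s ^ l)) sums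
          (of_real (pi ^ CARD('n)) * exp (of_real s * (of_real t * hdot z w)))"
        by (intro sums_mult exp_sums_power)
      ultimately show "(\<lambda>l. of_real (pi ^ CARD('n)) * ((of_real t * hdot z w) ^ l / fact l) * of_real s ^ l) sums
          (\<integral>x. exp (of_real s * hdot x w) * (exp (of_real t * hdot z x) * ?e x) \<partial>lborel)"
        by (simp only: mult.assoc)
    qed simp
    then show ?thesis by simp
  qed
  define g where "g x = hdot x w ^ l * ?e x" for x
  \<comment> \<open>After the extraction in \<open>s\<close>, the function of \<open>t\<close> is
    the single monomial of degree \<open>l\<close>, so its coefficient sequence has one nonzero
    place at most.\<close>
  define \<alpha> where "\<alpha> k = (if k = l then of_real (pi ^ CARD('n)) * hdot z w ^ l else 0)" for k
  have mg: "g \<in> borel_measurable lborel"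
    unfolding g_def by (intro borel_measurable_times borel_measurable_power mA me)
  have Wl: "integrable lborel (\<lambda>x. fact l * ?W x)" using W by simp
  have bound: "exp (1 * norm (hdot z x)) * norm (g x) \<le> fact l * ?W x" for x
  proof -
    have "norm (hdot x w) ^ l \<le> fact l * exp (norm (hdot x w))" by (rule power_le_fact_exp) simp
    also have "\<dots> \<le> fact l * exp (norm w * norm x)" using A[of x] by simp
    finally have "exp (1 * norm (hdot z x)) * (norm (hdot x w) ^ l * exp (- (norm x)\<^sup>2))
        \<le> exp (norm z * norm x) * (fact l * exp (norm w * norm x) * exp (- (norm x)\<^sup>2))"
      using B[of x] by (intro mult_mono) auto
    then show ?thesis unfolding We by (simp add: g_def norm_mult norm_power mult_ac)
  qed
  have gen: "(\<lambda>k. \<alpha> k * of_real t ^ k) sums (\<integral>x. exp (of_real t * hdot z x) * g x \<partial>lborel)"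
    if t: "0 < t" "t < 1" for t :: real
  proof -
    have "(\<integral>x. exp (of_real t * hdot z x) * g x \<partial>lborel) = of_real (pi ^ CARD('n)) * (of_real t * hdot z w) ^ l"
      unfolding m1[OF t, symmetric] g_def by (simp only: mult_ac)
    also have "\<dots> = \<alpha> l * of_real t ^ l" by (simp add: \<alpha>_def power_mult_distrib)
    finally show ?thesis
      using sums_single[of l "\<lambda>k. \<alpha> k * of_real t ^ k"]
      by (simp add: \<alpha>_def if_distrib[of "\<lambda>x. x * _"] cong: if_cong)
  qed
  have eq: "hdot x w ^ l * hdot z x ^ m * ?e x = hdot z x ^ m * g x" for x
    by (simp add: g_def)
  show "integrable lborel (\<lambda>x. hdot x w ^ l * hdot z x ^ m * ?e x)"
    unfolding eq by (rule integrable_moment_of_exp[OF mB mg Wl, where r=1 and \<alpha>=\<alpha>]) (use bound gen in \<open>auto\<close>)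
  have "(\<integral>x. hdot z x ^ m * g x \<partial>lborel) = fact m * \<alpha> m"
    by (rule moment_of_exp[OF mB mg Wl, where r=1]) (use bound gen in \<open>auto\<close>)
  then show "(\<integral>x. hdot x w ^ l * hdot z x ^ m * ?e x \<partial>lborel)
      = (if l = m then of_real (pi ^ CARD('n)) * fact l * hdot z w ^ l else 0)"
    unfolding eq by (simp add: \<alpha>_def)
qed

text \<open>The generating function is the Gaussian integral at rate \<open>1 - s\<close>, namely
  \<open>pi ^ n * (1 - s) powr (- n)\<close>, whose binomial coefficients are
  \<open>(n)_l / l!\<close>. Stopping at \<open>s < 1/2\<close> leaves
  \<open>exp (- (norm x)^2 / 2)\<close> as a majorant.\<close>

lemma integral_gaussian_even_norm_moment:
  "(\<integral>x. complex_of_real ((norm x)\<^sup>2) ^ l * of_real (exp (- (norm x)\<^sup>2)) \<partial>(lborel :: (complex ^ 'n::finite) measure))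
    = of_real (pi ^ CARD('n) * pochhammer (real CARD('n)) l)"
proof -
  let ?n = "real CARD('n)"
  let ?e = "\<lambda>x::complex ^ 'n. complex_of_real (exp (- (norm x)\<^sup>2))"
  have gauss: "integrable lborel (\<lambda>x::complex ^ 'n. exp (- (t * (norm x)\<^sup>2)))"
    "(\<integral>x. complex_of_real (exp (- (t * (norm x)\<^sup>2))) \<partial>(lborel :: (complex ^ 'n) measure)) = of_real ((pi / t) ^ CARD('n))"
    if t: "t > 0" for t
  proof -
    have "exp ((\<Sum>b\<in>Basis. 0 * of_real (x \<bullet> b)) - complex_of_real (t * (norm x)\<^sup>2)) = of_real (exp (- (t * (norm x)\<^sup>2)))" for x :: "complex ^ 'n"
      by (simp add: exp_of_real[symmetric])
    then have "has_bochner_integral lborel (\<lambda>x::complex ^ 'n. complex_of_real (exp (- (t * (norm x)\<^sup>2)))) (of_real (sqrt (pi / t)) ^ DIM(complex ^ 'n))"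
      using has_bochner_integral_gaussian_exp[OF t, of "\<lambda>_::complex ^ 'n. 0"] by simp
    moreover have "complex_of_real (sqrt (pi / t)) ^ DIM(complex ^ 'n) = of_real ((pi / t) ^ CARD('n))"
    proof -
      have "sqrt (pi / t) ^ DIM(complex ^ 'n) = (pi / t) ^ CARD('n)"
        using t by (simp add: power_mult mult.commute[of _ 2])
      then show ?thesis by (simp only: of_real_power[symmetric])
    qed
    ultimately show "integrable lborel (\<lambda>x::complex ^ 'n. exp (- (t * (norm x)\<^sup>2)))"
      "(\<integral>x. complex_of_real (exp (- (t * (norm x)\<^sup>2))) \<partial>(lborel :: (complex ^ 'n) measure)) = of_real ((pi / t) ^ CARD('n))"
      by (auto simp only: has_bochner_integral_iff complex_of_real_integrable_eq)
  qed
  have "(\<integral>x. complex_of_real ((norm x)\<^sup>2) ^ l * ?e x \<partial>lborel)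
      = fact l * of_real (pi ^ CARD('n) * pochhammer ?n l / fact l)"
  proof (rule moment_of_exp[OF _ _ gauss(1)[of "1/2"], where r="1/2"])
    fix x :: "complex ^ 'n"
    show "exp (1/2 * norm (complex_of_real ((norm x)\<^sup>2))) * norm (?e x) \<le> exp (- (1/2 * (norm x)\<^sup>2))"
      by (simp add: mult_exp_exp norm_power)
  next
    fix s :: real assume s: "0 < s" "s < 1/2"
    have "(\<integral>x. exp (of_real s * of_real ((norm x)\<^sup>2)) * ?e x \<partial>lborel) = (\<integral>x. complex_of_real (exp (- ((1 - s) * (norm x)\<^sup>2))) \<partial>(lborel :: (complex ^ 'n) measure))"
    proof -
      have "exp (of_real s * of_real N) * complex_of_real (exp (- N)) = of_real (exp (- ((1 - s) * N)))" for N :: real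
      proof -
        have "exp (of_real s * of_real N) * complex_of_real (exp (- N)) = of_real (exp (s * N) * exp (- N))"
          by (simp only: of_real_mult exp_of_real[symmetric])
        also have "exp (s * N) * exp (- N) = exp (- ((1 - s) * N))"
          by (simp add: mult_exp_exp algebra_simps)
        finally show ?thesis .
      qed
      then show ?thesis by (simp only:)
    qed
    also have "\<dots> = of_real ((pi / (1 - s)) ^ CARD('n))" using s by (intro gauss) auto
    also have "(pi / (1 - s)) ^ CARD('n) = pi ^ CARD('n) * (1 + - s) powr (- ?n)"
    proof -
      have "(1 + - s) powr (- ?n) = 1 / (1 - s) ^ CARD('n)"
        using s powr_realpow[of "1 - s" "CARD('n)"] by (simp add: powr_minus_divide)
      then show ?thesis by (simp only: power_divide) simp
    qed
    finally have I: "(\<integral>x. exp (of_real s * of_real ((norm x)\<^sup>2)) * ?e x \<partial>lborel) = of_real (pi ^ CARD('n) * (1 + - s) powr (- ?n))" .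
    have "(\<lambda>l. (- ?n gchoose l) * (- s) ^ l) sums (1 + - s) powr (- ?n)"
      by (rule gen_binomial_real) (use s in auto)
    moreover have "(- ?n gchoose l) * (- s) ^ l = pochhammer ?n l / fact l * s ^ l" for l
      by (simp add: gbinomial_pochhammer power_minus[of s])
    ultimately have "(\<lambda>l. complex_of_real (pi ^ CARD('n) * (pochhammer ?n l / fact l * s ^ l))) sums of_real (pi ^ CARD('n) * (1 + - s) powr (- ?n))"
      by (intro sums_of_real sums_mult) simp
    then show "(\<lambda>l. complex_of_real (pi ^ CARD('n) * pochhammer ?n l / fact l) * of_real s ^ l) sums
       (\<integral>x. exp (of_real s * of_real ((norm x)\<^sup>2)) * ?e x \<partial>lborel)"
      unfolding I by (simp add: mult.assoc)
  qed auto
  then show ?thesis by simp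
qed

text \<open>The integrand is homogeneous of degree \<open>l + m\<close> under positive real
  dilations, so its Gaussian integral is a radial factor times the sphere integral. For
  \<open>l = m\<close> the radial factor is an even norm moment, and the powers of \<open>pi\<close>
  cancel.\<close>

lemma sphere_hdot_moment:
  fixes w z :: "complex ^ 'n::finite"
  shows "(\<integral>x. hdot x w ^ l * hdot z x ^ m \<partial>sphere_measure)
    = (if l = m then of_real (fact l / pochhammer (real CARD('n)) l) * hdot z w ^ l else 0)"
proof -
  let ?e = "\<lambda>x::complex ^ 'n. complex_of_real (exp (- (norm x)\<^sup>2))"
  define \<rho> where "\<rho> r = complex_of_real (r ^ (l + m) * exp (- r\<^sup>2))" for r :: real
  define \<phi> where "\<phi> x = hdot x w ^ l * hdot z x ^ m" for x
  have eq: "hdot x w ^ l * hdot z x ^ m * ?e x = \<rho> (norm x) * \<phi> (sgn x)" for x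
  proof -
    have "x = norm x *\<^sub>R sgn x" by (cases "x = 0") (simp_all add: sgn_div_norm)
    then have "hdot x w = of_real (norm x) * hdot (sgn x) w" "hdot z x = of_real (norm x) * hdot z (sgn x)"
      by (metis hdot_scaleR)+
    then show ?thesis
      by (simp add: \<rho>_def \<phi>_def power_mult_distrib power_add)
  qed
  have \<rho>m: "\<rho> \<in> borel_measurable borel" unfolding \<rho>_def by measurable
  have \<phi>m: "\<phi> \<in> borel_measurable borel" unfolding \<phi>_def by measurable
  have key: "(\<integral>x. \<rho> (norm (x :: complex ^ 'n)) \<partial>lborel) * integral\<^sup>L sphere_measure \<phi>
     = (if l = m then of_real (pi ^ CARD('n)) * fact l * hdot z w ^ l else 0)"
    using polar_integral[OF \<rho>m \<phi>m] integral_gaussian_hdot_moment[of w l z m] unfolding eq by simp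
  have poch: "pochhammer (real CARD('n)) k > 0" for k by (intro pochhammer_pos) simp
  show ?thesis
  proof (cases "l = m")
    case True
    have "\<rho> (norm x) = complex_of_real ((norm x)\<^sup>2) ^ l * ?e x" for x :: "complex ^ 'n"
      using True by (simp add: \<rho>_def power_mult[symmetric] mult_2)
    then have "(\<integral>x. \<rho> (norm (x :: complex ^ 'n)) \<partial>lborel) = of_real (pi ^ CARD('n) * pochhammer (real CARD('n)) l)"
      by (simp only: integral_gaussian_even_norm_moment)
    with key True have "of_real (pi ^ CARD('n)) * (of_real (pochhammer (real CARD('n)) l) * integral\<^sup>L sphere_measure \<phi>)
        = of_real (pi ^ CARD('n)) * (fact l * hdot z w ^ l)"
      by (simp add: mult.assoc)
    then have "of_real (pochhammer (real CARD('n)) l) * integral\<^sup>L sphere_measure \<phi> = fact l * hdot z w ^ l" by simp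
    moreover have "complex_of_real (pochhammer (real CARD('n)) l) \<noteq> 0" using poch[of l] by simp
    ultimately show ?thesis using True unfolding \<phi>_def
      by (simp add: nonzero_eq_divide_eq mult.commute)
  next
    case False
    \<comment> \<open>For \<open>l \<noteq> m\<close> the degree \<open>l + m\<close> may be odd, so
      the radial factor is not evaluated; it only has to be nonzero. Were it 0, its nonnegative
      integrand would vanish almost everywhere, and with it the integrand of a positive even
      moment.\<close>
    have "(\<integral>x. \<rho> (norm (x :: complex ^ 'n)) \<partial>lborel) \<noteq> 0"
    proof
      assume "(\<integral>x. \<rho> (norm (x :: complex ^ 'n)) \<partial>lborel) = 0"
      then have I0: "(\<integral>x. norm x ^ (l + m) * exp (- (norm x)\<^sup>2) \<partial>(lborel :: (complex ^ 'n) measure)) = 0"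
        unfolding \<rho>_def integral_complex_of_real by simp
      have "integrable lborel (\<lambda>x::complex ^ 'n. norm x ^ (l + m) * exp (- (norm x)\<^sup>2))"
      proof (rule Bochner_Integration.integrable_bound)
        show "integrable lborel (\<lambda>x::complex ^ 'n. fact (l + m) * exp (1 * norm x - (norm x)\<^sup>2))"
          by (intro integrable_mult_right integrable_exp_norm_gaussian)
        show "AE x::complex ^ 'n in lborel. norm (norm x ^ (l + m) * exp (- (norm x)\<^sup>2)) \<le> norm (fact (l + m) * exp (1 * norm x - (norm x)\<^sup>2))"
        proof (rule AE_I2)
          fix x :: "complex ^ 'n"
          have "norm x ^ (l + m) * exp (- (norm x)\<^sup>2) \<le> fact (l + m) * exp (norm x) * exp (- (norm x)\<^sup>2)"
            by (intro mult_right_mono power_le_fact_exp) auto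
          then show "norm (norm x ^ (l + m) * exp (- (norm x)\<^sup>2)) \<le> norm (fact (l + m) * exp (1 * norm x - (norm x)\<^sup>2))"
            by (simp add: abs_mult exp_diff exp_minus divide_inverse mult.assoc)
        qed
      qed simp
      from integral_nonneg_eq_0_iff_AE[OF this] I0
      have AE0: "AE x in (lborel :: (complex ^ 'n) measure). norm x ^ (l + m) * exp (- (norm x)\<^sup>2) = 0" by simp
      have "(\<integral>x. complex_of_real ((norm x)\<^sup>2) ^ (l + m) * ?e x \<partial>lborel) = (\<integral>x. 0 \<partial>(lborel :: (complex ^ 'n) measure))"
        by (rule integral_cong_AE) (use AE0 False in \<open>auto elim!: eventually_mono\<close>)
      then have "complex_of_real (pi ^ CARD('n) * pochhammer (real CARD('n)) (l + m)) = 0"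
        by (simp only: integral_gaussian_even_norm_moment Bochner_Integration.integral_zero)
      then show False using poch[of "l + m"] by simp
    qed
    with key False show ?thesis unfolding \<phi>_def by simp
  qed
qed

section \<open>Kernels and the Bessel function\<close>

text \<open>Each factor \<open>(n + j) / (n + p + j)\<close> is at most
  \<open>max 1 (n / (n + p))\<close>, the second entry being the one that matters for negative
  \<open>p\<close>. Geometric growth is good enough, since the kernel series also carries
  \<open>1 / l!\<close>.\<close>

lemma kernel_coeff_bounds:
  assumes "real n + p > 0"
  shows "0 \<le> kernel_coeff n p l" and "kernel_coeff n p l \<le> sqrt (max 1 (real n / (real n + p))) ^ l"
    and "(kernel_coeff n p l)\<^sup>2 = pochhammer (real n) l / pochhammer (real n + p) l"
proof -
  let ?M = "max 1 (real n / (real n + p))"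
  have pos: "pochhammer (real n + p) l > 0" for l using assms by (rule pochhammer_pos)
  have nn: "pochhammer (real n) l \<ge> 0" for l
    by (cases "n = 0") (auto simp: pochhammer_0_left intro!: less_imp_le[OF pochhammer_pos])
  have "pochhammer (real n) l \<le> ?M ^ l * pochhammer (real n + p) l"
  proof (induction l)
    case (Suc l)
    have "real n = real n / (real n + p) * (real n + p)" using assms by simp
    also have "\<dots> \<le> ?M * (real n + p)" using assms by (intro mult_right_mono) auto
    finally have "real n \<le> ?M * (real n + p)" .
    moreover have "1 * real l \<le> ?M * real l" by (intro mult_right_mono) auto
    ultimately have "real n + real l \<le> ?M * (real n + p + real l)" by (simp add: distrib_left)
    with Suc have "pochhammer (real n) l * (real n + real l) \<le> ?M ^ l * pochhammer (real n + p) l * (?M * (real n + p + real l))"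
      using pos[of l] by (intro mult_mono) auto
    then show ?case by (simp add: pochhammer_Suc mult_ac)
  qed simp
  then have "pochhammer (real n) l / pochhammer (real n + p) l \<le> ?M ^ l"
    using pos[of l] by (simp add: divide_le_eq)
  then have "kernel_coeff n p l \<le> sqrt (?M ^ l)" unfolding kernel_coeff_def by simp
  then show "kernel_coeff n p l \<le> sqrt ?M ^ l" by (simp add: real_sqrt_power)
  show "0 \<le> kernel_coeff n p l" "(kernel_coeff n p l)\<^sup>2 = pochhammer (real n) l / pochhammer (real n + p) l"
    using pos[of l] nn[of l] by (simp_all add: kernel_coeff_def)
qed

lemma K_kernel_expansion:
  fixes z x :: "complex ^ 'n::finite"
  assumes p: "real CARD('n) + p > 0" and h: "h > 0"
  defines "M \<equiv> sqrt (max 1 (real CARD('n) / (real CARD('n) + p)))"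
    and "f \<equiv> \<lambda>l. complex_of_real (kernel_coeff CARD('n) p l / (fact l * h ^ l)) * hdot x z ^ l"
  shows "(\<Sum>l<N. norm (f l)) \<le> exp (M * (norm x * norm z) / h)" and "f sums K_kernel h p x z"
proof -
  have M: "M \<ge> 0" unfolding M_def by simp
  have tm: "norm (f l) \<le> (M * (norm x * norm z) / h) ^ l / fact l" for l
  proof -
    have "norm (f l) = kernel_coeff CARD('n) p l / (fact l * h ^ l) * norm (hdot x z) ^ l"
      using kernel_coeff_bounds(1)[OF p, of l] h unfolding f_def norm_mult norm_of_real norm_power by simp
    also have "\<dots> \<le> M ^ l / (fact l * h ^ l) * (norm x * norm z) ^ l"
      using kernel_coeff_bounds(2)[OF p, of l] M h norm_hdot_le[of x z] unfolding M_def[symmetric]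
      by (intro mult_mono divide_right_mono power_mono) auto
    also have "\<dots> = (M * (norm x * norm z) / h) ^ l / fact l"
      by (simp add: power_mult_distrib power_divide)
    finally show ?thesis .
  qed
  show "(\<Sum>l<N. norm (f l)) \<le> exp (M * (norm x * norm z) / h)" for N
  proof -
    have "(\<Sum>l<N. norm (f l)) \<le> (\<Sum>l<N. (M * (norm x * norm z) / h) ^ l / fact l)"
      by (intro sum_mono tm)
    also have "\<dots> \<le> exp (M * (norm x * norm z) / h)"
      using M h by (intro exp_partial_sum_le) auto
    finally show ?thesis .
  qed
  have "summable (\<lambda>l. (M * (norm x * norm z) / h) ^ l / fact l)"
    using summable_exp[of "M * (norm x * norm z) / h"] by (simp add: divide_inverse mult.commute)
  then have "summable f"
    by (rule summable_comparison_test'[where N=0]) (rule tm)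
  moreover have "(\<lambda>l. complex_of_real (kernel_coeff CARD('n) p l / fact l) * (hdot x z / complex_of_real h) ^ l) = f"
    by (auto simp: f_def power_divide)
  ultimately show "f sums K_kernel h p x z"
    unfolding K_kernel_def by (simp add: summable_sums)
qed

section \<open>Termwise integration of the kernels over the sphere\<close>

lemma finite_measure_sphere_measure: "finite_measure (sphere_measure :: 'a::euclidean_space measure)"
proof -
  interpret prob_space "sphere_distr :: 'a measure" by (rule prob_space_sphere_distr)
  show ?thesis
    unfolding sphere_measure_def sphere_distr_def[symmetric]
    by (rule finite_measure_restrict_space) (auto intro: finite_measure_axioms)
qed

lemma norm_space_sphere_measure: "x \<in> space sphere_measure \<Longrightarrow> norm x = 1"
  by (simp add: sphere_measure_def space_restrict_space)

lemma borel_measurable_sphere_measure: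
  "f \<in> borel_measurable borel \<Longrightarrow> f \<in> borel_measurable sphere_measure"
  unfolding sphere_measure_def by (rule measurable_restrict_space1) simp

text \<open>The two series are integrated one after the other, and orthogonality collapses the inner
  one to its term \<open>m = l\<close>. The \<open>(n)_l\<close> in the squared coefficient cancels
  the \<open>(n)_l\<close> of the sphere moment, which leaves exactly the 0F1 coefficient with
  \<open>(n + p)_l\<close>. On the sphere \<open>norm x = 1\<close>, so the majorants are
  constants.\<close>

lemma sphere_inner_K_kernel:
  fixes z w :: "complex ^ 'n::finite"
  assumes p: "real CARD('n) + p > 0" and h: "h > 0"
  shows "sphere_inner (\<lambda>x. K_kernel h p x w) (\<lambda>x. K_kernel h p x z)
    = hyp0F1 (real CARD('n) + p) (hdot z w / of_real h ^ 2)"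
proof -
  interpret finite_measure "sphere_measure :: (complex ^ 'n) measure" by (rule finite_measure_sphere_measure)
  define M where "M = sqrt (max 1 (real CARD('n) / (real CARD('n) + p)))"
  define c where "c l = kernel_coeff CARD('n) p l / (fact l * h ^ l)" for l
  define G where "G x = cnj (K_kernel h p x z)" for x
  note Kw = K_kernel_expansion[OF p h, where z=w, folded M_def, folded c_def]
  note Kz = K_kernel_expansion[OF p h, where z=z, folded M_def, folded c_def]
  have Gs: "(\<lambda>m. of_real (c m) * hdot z x ^ m) sums G x" for x
  proof -
    have "(\<lambda>m. cnj (of_real (c m) * hdot x z ^ m)) sums G x"
      unfolding G_def sums_cnj by (rule Kz(2))
    then show ?thesis by (simp add: cnj_hdot)
  qed
  have Gn: "(\<Sum>m<N. norm (of_real (c m) * hdot z x ^ m)) \<le> exp (M * (norm x * norm z) / h)" for x N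
    using Kz(1)[where x=x and N=N] by (simp add: cnj_hdot[of x z, symmetric] norm_mult norm_power)
  have Gb: "norm (G x) \<le> exp (M * (norm x * norm z) / h)" for x
  proof (rule LIMSEQ_le_const2)
    show "(\<lambda>N. norm (\<Sum>m<N. of_real (c m) * hdot z x ^ m)) \<longlonglongrightarrow> norm (G x)"
      using Gs[of x] unfolding sums_def by (rule tendsto_norm)
    show "\<exists>N. \<forall>n\<ge>N. norm (\<Sum>m<n. of_real (c m) * hdot z x ^ m) \<le> exp (M * (norm x * norm z) / h)"
      using order_trans[OF norm_sum Gn] by blast
  qed
  have mA: "(\<lambda>x. hdot x w ^ l) \<in> borel_measurable borel" for l
    by (intro borel_measurable_power hdot_borel_measurable)
  have mB: "(\<lambda>x. of_real (c m) * hdot z x ^ m) \<in> borel_measurable borel" for m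
    by (intro borel_measurable_times borel_measurable_power borel_measurable_const hdot_borel_measurable)
  have mG: "G \<in> borel_measurable borel"
    by (rule borel_measurable_LIMSEQ_metric[where f="\<lambda>N x. \<Sum>m<N. of_real (c m) * hdot z x ^ m"])
       (use Gs in \<open>auto simp: sums_def intro!: borel_measurable_sum mB\<close>)
  have inner: "(\<integral>x. hdot x w ^ l * G x \<partial>sphere_measure) = of_real (c l * (fact l / pochhammer (real CARD('n)) l)) * hdot z w ^ l" for l
  proof -
    have "(\<lambda>m. \<integral>x. hdot x w ^ l * (of_real (c m) * hdot z x ^ m) \<partial>sphere_measure) sums (\<integral>x. hdot x w ^ l * G x \<partial>sphere_measure)"
    proof (rule integral_sums_dominated)
      show "integrable sphere_measure (\<lambda>_::complex ^ 'n. norm w ^ l * exp (M * norm z / h))" by simp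
      show "(\<lambda>x. hdot x w ^ l * (of_real (c m) * hdot z x ^ m)) \<in> borel_measurable sphere_measure" for m
        by (intro borel_measurable_sphere_measure borel_measurable_times mA mB)
      fix x :: "complex ^ 'n" assume "x \<in> space sphere_measure"
      then have x: "norm x = 1" by (rule norm_space_sphere_measure)
      show "(\<lambda>m. hdot x w ^ l * (of_real (c m) * hdot z x ^ m)) sums (hdot x w ^ l * G x)"
        by (intro sums_mult Gs)
      fix N
      have "(\<Sum>m<N. norm (hdot x w ^ l * (of_real (c m) * hdot z x ^ m))) = norm (hdot x w) ^ l * (\<Sum>m<N. norm (of_real (c m) * hdot z x ^ m))"
        by (simp only: norm_mult norm_power sum_distrib_left)
      also have "\<dots> \<le> norm w ^ l * exp (M * norm z / h)"
        using Gn[where x=x and N=N] norm_hdot_le[of x w] x by (intro mult_mono power_mono) (auto intro: sum_nonneg)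
      finally show "(\<Sum>m<N. norm (hdot x w ^ l * (of_real (c m) * hdot z x ^ m))) \<le> norm w ^ l * exp (M * norm z / h)" .
    qed
    moreover have "(\<integral>x. hdot x w ^ l * (of_real (c m) * hdot z x ^ m) \<partial>sphere_measure)
        = (if m = l then of_real (c l * (fact l / pochhammer (real CARD('n)) l)) * hdot z w ^ l else 0)" for m
    proof -
      have "(\<integral>x. hdot x w ^ l * (of_real (c m) * hdot z x ^ m) \<partial>sphere_measure)
          = of_real (c m) * (\<integral>x. hdot x w ^ l * hdot z x ^ m \<partial>sphere_measure)"
        by (simp only: integral_mult_right_zero[symmetric] mult_ac)
      then show ?thesis by (simp add: sphere_hdot_moment)
    qed
    ultimately show ?thesis
      using sums_single[of l "\<lambda>_. of_real (c l * (fact l / pochhammer (real CARD('n)) l)) * hdot z w ^ l"]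
      by (simp only: sums_unique2)
  qed
  have "(\<lambda>l. \<integral>x. of_real (c l) * hdot x w ^ l * G x \<partial>sphere_measure) sums (\<integral>x. K_kernel h p x w * G x \<partial>sphere_measure)"
  proof (rule integral_sums_dominated)
    show "integrable sphere_measure (\<lambda>_::complex ^ 'n. exp (M * norm w / h) * exp (M * norm z / h))" by simp
    show "(\<lambda>x. of_real (c l) * hdot x w ^ l * G x) \<in> borel_measurable sphere_measure" for l
      by (intro borel_measurable_sphere_measure borel_measurable_times borel_measurable_const mA mG)
    fix x :: "complex ^ 'n" assume "x \<in> space sphere_measure"
    then have x: "norm x = 1" by (rule norm_space_sphere_measure)
    show "(\<lambda>l. of_real (c l) * hdot x w ^ l * G x) sums (K_kernel h p x w * G x)"
      by (intro sums_mult2 Kw(2))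
    fix N
    have "(\<Sum>l<N. norm (of_real (c l) * hdot x w ^ l * G x)) = (\<Sum>l<N. norm (of_real (c l) * hdot x w ^ l)) * norm (G x)"
      by (simp only: norm_mult[of _ "G x"] sum_distrib_right)
    also have "\<dots> \<le> exp (M * norm w / h) * exp (M * norm z / h)"
      using Kw(1)[where x=x and N=N] Gb[of x] x by (intro mult_mono) auto
    finally show "(\<Sum>l<N. norm (of_real (c l) * hdot x w ^ l * G x)) \<le> exp (M * norm w / h) * exp (M * norm z / h)" .
  qed
  moreover have "(\<integral>x. of_real (c l) * hdot x w ^ l * G x \<partial>sphere_measure)
      = (hdot z w / of_real h ^ 2) ^ l / of_real (fact l * pochhammer (real CARD('n) + p) l)" for l
  proof -
    have poch: "pochhammer (real CARD('n)) l > 0" "pochhammer (real CARD('n) + p) l > 0"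
      using p by (auto intro: pochhammer_pos)
    have "c l * (c l * (fact l / pochhammer (real CARD('n)) l)) = (kernel_coeff CARD('n) p l)\<^sup>2 * (fact l / pochhammer (real CARD('n)) l) / (fact l * h ^ l)\<^sup>2"
      by (simp add: c_def power2_eq_square)
    also have "\<dots> = 1 / ((h\<^sup>2) ^ l * (fact l * pochhammer (real CARD('n) + p) l))"
      unfolding kernel_coeff_bounds(3)[OF p] using poch h
      by (simp add: power2_eq_square power_mult_distrib)
    finally have cc: "c l * (c l * (fact l / pochhammer (real CARD('n)) l)) = 1 / ((h\<^sup>2) ^ l * (fact l * pochhammer (real CARD('n) + p) l))" .
    have "(\<integral>x. of_real (c l) * hdot x w ^ l * G x \<partial>sphere_measure) = of_real (c l) * (\<integral>x. hdot x w ^ l * G x \<partial>sphere_measure)"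
      by (simp only: mult.assoc integral_mult_right_zero)
    also have "\<dots> = of_real (c l * (c l * (fact l / pochhammer (real CARD('n)) l))) * hdot z w ^ l"
      unfolding inner by (simp only: of_real_mult mult.assoc)
    finally show ?thesis unfolding cc by (simp add: power_divide)
  qed
  ultimately show ?thesis
    using hyp0F1_sums[OF p, of "hdot z w / of_real h ^ 2"]
    unfolding sphere_inner_def G_def by (simp only: sums_unique2)
qed

text \<open>The imaginary part of \<open>ln u / 2\<close> stays within
  \<open>(- pi/2, pi/2]\<close>, so \<open>ln\<close> undoes the exponential without a jump and the
  principal powers match.\<close>

lemma csqrt_powr:
  assumes "u \<noteq> 0"
  shows "csqrt u powr s = u powr (s / 2)"
proof -
  have L: "ln (exp (ln u / 2)) = ln u / 2"
    using mpi_less_Im_Ln[OF assms] Im_Ln_le_pi[OF assms] by (intro Ln_exp) auto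
  show ?thesis using assms unfolding csqrt_exp_Ln[OF assms] powr_def L by simp
qed

lemma csqrt_divide_square:
  assumes "h > 0"
  shows "csqrt (u / complex_of_real h ^ 2) = csqrt u / complex_of_real h"
  using csqrt_principal[of u] assms by (intro csqrt_unique) (auto simp: power_divide)

text \<open>With \<open>v = csqrt u\<close>, the factor \<open>v powr (a - 1)\<close> of
  \<open>bessel_I\<close> cancels the power of \<open>u\<close> in \<open>T_fun\<close>. At
  \<open>hdot z w = 0\<close> this would fail, since \<open>0 powr s = 0\<close> makes
  \<open>T_fun\<close> vanish while 0F1 is 1.\<close>

lemma T_fun_eq_hyp0F1:
  fixes z w :: "complex ^ 'n::finite"
  assumes p: "real CARD('n) + p > 0" and h: "h > 0" and zw: "hdot z w \<noteq> 0"
  shows "T_fun h p z w = hyp0F1 (real CARD('n) + p) (hdot z w / of_real h ^ 2)"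
proof -
  define a where "a = real CARD('n) + p"
  define u where "u = hdot z w / complex_of_real h ^ 2"
  define v where "v = csqrt (hdot z w) / complex_of_real h"
  have a: "a > 0" and u: "u \<noteq> 0" using p h zw by (auto simp: a_def u_def)
  have vu: "v = csqrt u" and v2: "v\<^sup>2 = u"
    using csqrt_divide_square[OF h, of "hdot z w"] by (simp_all add: v_def u_def power_divide)
  have Ga: "Gamma a > 0" using a by (rule Gamma_real_pos)
  have tm: "rGamma (complex_of_real (a - 1) + of_nat k + 1) / fact k * v ^ (2 * k)
      = of_real (1 / Gamma a) * (u ^ k / of_real (fact k * pochhammer a k))" for k
  proof -
    have "complex_of_real (a - 1) + of_nat k + 1 = of_real (a + real k)" by simp
    then have "rGamma (complex_of_real (a - 1) + of_nat k + 1) = of_real (rGamma (a + real k))"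
      by (simp only: rGamma_complex_of_real)
    also have "rGamma (a + real k) = 1 / (Gamma a * pochhammer a k)"
    proof -
      have "a \<notin> \<int>\<^sub>\<le>\<^sub>0" using a by (auto elim!: nonpos_Ints_cases)
      then have "Gamma (a + real k) = Gamma a * pochhammer a k" using Ga by (simp add: pochhammer_Gamma)
      then show ?thesis by (simp add: rGamma_inverse_Gamma divide_inverse)
    qed
    finally show ?thesis by (simp add: power_mult v2)
  qed
  have "(\<Sum>k. rGamma (complex_of_real (a - 1) + of_nat k + 1) / fact k * v ^ (2 * k)) = of_real (1 / Gamma a) * hyp0F1 a u"
    unfolding tm by (rule sums_unique[symmetric]) (intro sums_mult hyp0F1_sums a)
  then have "bessel_I (of_real (a - 1)) (2 * v) = v powr of_real (a - 1) * (of_real (1 / Gamma a) * hyp0F1 a u)"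
    by (simp add: bessel_I_def)
  moreover have "u powr of_real (1/2 * (- p - real CARD('n) + 1)) * v powr of_real (a - 1) = 1"
  proof -
    have "v powr of_real (a - 1) = u powr of_real (1/2 * (a - 1))" unfolding vu csqrt_powr[OF u] by simp
    then have "u powr of_real (1/2 * (- p - real CARD('n) + 1)) * v powr of_real (a - 1)
        = u powr (of_real (1/2 * (- p - real CARD('n) + 1)) + of_real (1/2 * (a - 1)))"
      by (simp only: powr_add)
    also have "complex_of_real (1/2 * (- p - real CARD('n) + 1)) + of_real (1/2 * (a - 1)) = 0"
    proof -
      have "1/2 * (- p - real CARD('n) + 1) + 1/2 * (a - 1) = 0" by (simp add: a_def field_simps)
      then show ?thesis by (simp only: of_real_add[symmetric] of_real_0)
    qed
    finally show ?thesis using u by simp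
  qed
  moreover have "T_fun h p z w = of_real (Gamma a) * u powr of_real (1/2 * (- p - real CARD('n) + 1)) * bessel_I (of_real (a - 1)) (2 * v)"
    by (simp add: T_fun_def a_def u_def v_def)
  ultimately have "T_fun h p z w = of_real (Gamma a) * (u powr of_real (1/2 * (- p - real CARD('n) + 1)) * v powr of_real (a - 1)) * (of_real (1 / Gamma a) * hyp0F1 a u)"
    by (simp only: mult_ac)
  also have "\<dots> = hyp0F1 a u" using \<open>u powr _ * v powr _ = 1\<close> Ga by simp
  finally show ?thesis by (simp add: a_def u_def)
qed

text \<open>Halving the argument brings it strictly inside \<open>(- pi/2, pi/2)\<close>. This is
  how the condition on \<open>Arg\<close> enters the asymptotics.\<close>

lemma Re_csqrt_pos:
  assumes "u \<noteq> 0" "\<bar>Arg u\<bar> < pi"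
  shows "Re (csqrt u) > 0"
proof -
  have "csqrt u = exp (ln u / 2)" using assms(1) by (rule csqrt_exp_Ln)
  moreover have "cos (Im (ln u) / 2) > 0"
    using assms Arg_eq_Im_Ln[OF assms(1)] by (intro cos_gt_zero_pi) auto
  ultimately show ?thesis by (simp add: Re_exp)
qed

text \<open>\<open>R\<close> is the exact remainder of the normalised 0F1 at
  \<open>csqrt (hdot z w) / h\<close>. The identity therefore holds for every \<open>h > 0\<close>,
  and only the size of \<open>R\<close> is an asymptotic matter.\<close>

lemma T_fun_asymptotics:
  fixes z w :: "complex ^ 'n::finite"
  assumes p: "real CARD('n) + p > 0" and zw: "hdot z w \<noteq> 0" "\<bar>Arg (hdot z w)\<bar> < pi"
  obtains R where "R \<in> O[at_right 0](\<lambda>h. complex_of_real (h ^ 2))"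
    and "\<And>h. h > 0 \<Longrightarrow> T_fun h p z w =
       complex_of_real (Gamma (real CARD('n) + p) / (2 * sqrt pi))
       * (hdot z w / complex_of_real h ^ 2) powr complex_of_real (1/2 * (- p - real CARD('n) + 1/2))
       * exp (2 / complex_of_real h * csqrt (hdot z w))
       * (1 - complex_of_real ((real CARD('n) + p - 3/2) * (real CARD('n) + p - 1/2))
            / (4 * csqrt (hdot z w)) * complex_of_real h + R h)"
proof -
  define a where "a = real CARD('n) + p"
  define v where "v = csqrt (hdot z w)"
  have a: "a > 0" using p by (simp add: a_def)
  have v: "Re v > 0" "v \<noteq> 0" using Re_csqrt_pos[OF zw] by (auto simp: v_def)
  define R where "R h = scaled_hyp0F1_error a (v / of_real h)" for h
  have Ga: "Gamma a > 0" using a by (rule Gamma_real_pos)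
  show thesis
  proof (rule that[of R])
    \<comment> \<open>\<open>Re y / norm y\<close> is constant along the ray
      \<open>y = v / h\<close>, which dictates the sector constant; \<open>norm y \<ge> 1\<close>
      amounts to \<open>h \<le> norm v\<close>.\<close>
    obtain C where C: "\<And>y. norm y \<ge> 1 \<Longrightarrow> Re v / norm v * norm y \<le> Re y \<Longrightarrow> norm (scaled_hyp0F1_error a y) \<le> C / (norm y)\<^sup>2"
      using scaled_hyp0F1_error_bound[OF a, of "Re v / norm v"] v by auto
    have "norm (R h) \<le> C / (norm v)\<^sup>2 * norm (complex_of_real (h ^ 2))" if h: "0 < h" "h < norm v" for h
    proof -
      have "norm (R h) \<le> C / (norm (v / of_real h))\<^sup>2"
        unfolding R_def using h v by (intro C) (auto simp: norm_divide)
      also have "\<dots> = C / (norm v)\<^sup>2 * norm (complex_of_real (h ^ 2))"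
        using h by (simp only: norm_divide norm_of_real) (simp add: power_divide norm_power)
      finally show ?thesis .
    qed
    then have "\<forall>\<^sub>F h in at_right 0. norm (R h) \<le> C / (norm v)\<^sup>2 * norm (complex_of_real (h ^ 2))"
      using v by (auto simp: eventually_at_right_field intro!: exI[of _ "norm v"])
    then show "R \<in> O[at_right 0](\<lambda>h. complex_of_real (h ^ 2))" by (rule bigoI)
  next
    fix h :: real assume h: "h > 0"
    define u where "u = hdot z w / complex_of_real h ^ 2"
    define y where "y = v / of_real h"
    have u: "u \<noteq> 0" and y: "y \<noteq> 0" using zw h v by (auto simp: u_def y_def)
    have yu: "y = csqrt u" and y2: "y\<^sup>2 = u"
      using csqrt_divide_square[OF h, of "hdot z w"] by (simp_all add: v_def u_def y_def power_divide)
    have T: "T_fun h p z w = hyp0F1 a (y\<^sup>2)"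
      using T_fun_eq_hyp0F1[OF p h zw(1)] by (simp add: a_def u_def y2)
    have pw: "u powr complex_of_real (1/2 * (- p - real CARD('n) + 1/2)) * y powr of_real (a - 1/2) = 1"
    proof -
      have "y powr of_real (a - 1/2) = u powr of_real (1/2 * (a - 1/2))" unfolding yu csqrt_powr[OF u] by simp
      then have "u powr of_real (1/2 * (- p - real CARD('n) + 1/2)) * y powr of_real (a - 1/2)
          = u powr (of_real (1/2 * (- p - real CARD('n) + 1/2)) + of_real (1/2 * (a - 1/2)))"
        by (simp only: powr_add)
      also have "complex_of_real (1/2 * (- p - real CARD('n) + 1/2)) + of_real (1/2 * (a - 1/2)) = 0"
      proof -
        have "1/2 * (- p - real CARD('n) + 1/2) + 1/2 * (a - 1/2) = 0" by (simp add: a_def field_simps)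
        then show ?thesis by (simp only: of_real_add[symmetric] of_real_0)
      qed
      finally show ?thesis using u by simp
    qed
    have ex: "exp (2 * y) * exp (- (2 * y)) = 1" by (simp add: exp_add[symmetric])
    have G1: "complex_of_real (Gamma a / (2 * sqrt pi)) * of_real (2 * sqrt pi / Gamma a) = 1"
      using Ga by (simp flip: of_real_mult)
    have "complex_of_real (Gamma a / (2 * sqrt pi)) * u powr complex_of_real (1/2 * (- p - real CARD('n) + 1/2)) * exp (2 * y) * scaled_hyp0F1 a y
        = (complex_of_real (Gamma a / (2 * sqrt pi)) * of_real (2 * sqrt pi / Gamma a))
        * (u powr complex_of_real (1/2 * (- p - real CARD('n) + 1/2)) * y powr of_real (a - 1/2))
        * (exp (2 * y) * exp (- (2 * y))) * hyp0F1 a (y\<^sup>2)"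
      unfolding scaled_hyp0F1_def by (simp only: mult_ac)
    also have "\<dots> = T_fun h p z w" unfolding pw ex G1 T by simp
    also have "scaled_hyp0F1 a y = 1 - of_real ((a - 3/2) * (a - 1/2)) / (4 * v) * of_real h + R h"
      using h v by (simp add: R_def y_def scaled_hyp0F1_error_def)
    also have "2 * y = 2 / of_real h * v" by (simp add: y_def)
    finally show "T_fun h p z w =
       complex_of_real (Gamma (real CARD('n) + p) / (2 * sqrt pi))
       * (hdot z w / complex_of_real h ^ 2) powr complex_of_real (1/2 * (- p - real CARD('n) + 1/2))
       * exp (2 / complex_of_real h * csqrt (hdot z w))
       * (1 - complex_of_real ((real CARD('n) + p - 3/2) * (real CARD('n) + p - 1/2))
            / (4 * csqrt (hdot z w)) * complex_of_real h + R h)"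
      unfolding a_def[symmetric] v_def[symmetric] u_def[symmetric] by (rule sym)
  qed
qed

section \<open>The diagonal case \<open>w = z\<close>: squared norms\<close>

lemma sphere_norm_square: "(sphere_norm f)\<^sup>2 = Re (sphere_inner f f)"
proof -
  have "sphere_inner f f = of_real (\<integral>x. (norm (f x))\<^sup>2 \<partial>sphere_measure)"
    unfolding sphere_inner_def complex_norm_square[symmetric] by (simp only: integral_complex_of_real)
  then have "Re (sphere_inner f f) \<ge> 0" by simp
  then show ?thesis by (simp add: sphere_norm_def)
qed

theorem proposition3p1:
  fixes p :: real
  assumes "p > - real CARD('n::finite)"
  shows
   "(\<forall>z w :: complex ^ 'n. hdot z w \<noteq> 0 \<longrightarrow> \<bar>Arg (hdot z w)\<bar> < pi \<longrightarrow>
      (\<forall>h>0. sphere_inner (\<lambda>x. K_kernel h p x w) (\<lambda>x. K_kernel h p x z) = T_fun h p z w) \<and>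
      (\<exists>R :: real \<Rightarrow> complex. R \<in> O[at_right 0](\<lambda>h. complex_of_real (h ^ 2)) \<and>
        (\<forall>h>0. T_fun h p z w =
           complex_of_real (Gamma (real CARD('n) + p) / (2 * sqrt pi))
           * (hdot z w / complex_of_real h ^ 2)
               powr complex_of_real (1/2 * (- p - real CARD('n) + 1/2))
           * exp (2 / complex_of_real h * csqrt (hdot z w))
           * (1 - complex_of_real ((real CARD('n) + p - 3/2) * (real CARD('n) + p - 1/2))
                    / (4 * csqrt (hdot z w)) * complex_of_real h
                + R h)))) \<and>
    (\<forall>z :: complex ^ 'n. z \<noteq> 0 \<longrightarrow>
      (\<exists>R :: real \<Rightarrow> real. R \<in> O[at_right 0](\<lambda>h. h ^ 2) \<and>
        (\<forall>h>0. (sphere_norm (\<lambda>x. K_kernel h p x z)) ^ 2 =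
           Gamma (real CARD('n) + p) / (2 * sqrt pi)
           * (norm z / h) powr (- p - real CARD('n) + 1/2)
           * exp (2 / h * norm z)
           * (1 - (real CARD('n) + p - 3/2) * (real CARD('n) + p - 1/2) / (4 * norm z) * h
                + R h))))"
proof (intro conjI allI impI)
  have p: "real CARD('n) + p > 0" using assms by simp
  {
    fix z w :: "complex ^ 'n"
    assume zw: "hdot z w \<noteq> 0" "\<bar>Arg (hdot z w)\<bar> < pi"
    show "sphere_inner (\<lambda>x. K_kernel h p x w) (\<lambda>x. K_kernel h p x z) = T_fun h p z w" if "h > 0" for h
      using sphere_inner_K_kernel[OF p that] T_fun_eq_hyp0F1[OF p that zw(1)] by simp
    show "\<exists>R :: real \<Rightarrow> complex. R \<in> O[at_right 0](\<lambda>h. complex_of_real (h ^ 2)) \<and>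
        (\<forall>h>0. T_fun h p z w =
           complex_of_real (Gamma (real CARD('n) + p) / (2 * sqrt pi))
           * (hdot z w / complex_of_real h ^ 2)
               powr complex_of_real (1/2 * (- p - real CARD('n) + 1/2))
           * exp (2 / complex_of_real h * csqrt (hdot z w))
           * (1 - complex_of_real ((real CARD('n) + p - 3/2) * (real CARD('n) + p - 1/2))
                    / (4 * csqrt (hdot z w)) * complex_of_real h
                + R h))"
      by (rule T_fun_asymptotics[OF p zw]) blast
  }
  fix z :: "complex ^ 'n" assume z: "z \<noteq> 0"
  have zz: "hdot z z = of_real ((norm z)\<^sup>2)" by (rule hdot_self)
  then have zz0: "hdot z z \<noteq> 0" and Arg: "\<bar>Arg (hdot z z)\<bar> < pi"
    using z Arg_of_real[of "(norm z)\<^sup>2"] by auto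
  have sq: "csqrt (hdot z z) = of_real (norm z)"
    unfolding zz using z by (intro csqrt_unique) auto
  obtain R where R: "R \<in> O[at_right 0](\<lambda>h. complex_of_real (h ^ 2))"
    and T: "\<And>h. h > 0 \<Longrightarrow> T_fun h p z z =
       complex_of_real (Gamma (real CARD('n) + p) / (2 * sqrt pi))
       * (hdot z z / complex_of_real h ^ 2) powr complex_of_real (1/2 * (- p - real CARD('n) + 1/2))
       * exp (2 / complex_of_real h * csqrt (hdot z z))
       * (1 - complex_of_real ((real CARD('n) + p - 3/2) * (real CARD('n) + p - 1/2))
            / (4 * csqrt (hdot z z)) * complex_of_real h + R h)"
    using T_fun_asymptotics[OF p zz0 Arg] by blast
  show "\<exists>R :: real \<Rightarrow> real. R \<in> O[at_right 0](\<lambda>h. h ^ 2) \<and>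
        (\<forall>h>0. (sphere_norm (\<lambda>x. K_kernel h p x z)) ^ 2 =
           Gamma (real CARD('n) + p) / (2 * sqrt pi)
           * (norm z / h) powr (- p - real CARD('n) + 1/2)
           * exp (2 / h * norm z)
           * (1 - (real CARD('n) + p - 3/2) * (real CARD('n) + p - 1/2) / (4 * norm z) * h
                + R h))"
  \<comment> \<open>For \<open>w = z\<close> every other factor is real, so real parts can be taken
    throughout, and \<open>\<bar>Re (R h)\<bar> \<le> norm (R h)\<close> keeps the order.\<close>
  proof (intro exI[of _ "\<lambda>h. Re (R h)"] conjI allI impI)
    obtain c where "\<forall>\<^sub>F h in at_right 0. norm (R h) \<le> c * norm (complex_of_real (h ^ 2))"
      using R by (elim landau_o.bigE)
    then show "(\<lambda>h. Re (R h)) \<in> O[at_right 0](\<lambda>h. h ^ 2)"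
      by (intro bigoI[where c=c], elim eventually_mono)
         (simp only: norm_of_real real_norm_def order_trans[OF abs_Re_le_cmod])
  next
    fix h :: real assume h: "h > 0"
    define e where "e = - p - real CARD('n) + 1/2"
    define b where "b = (real CARD('n) + p - 3/2) * (real CARD('n) + p - 1/2)"
    define P where "P = Gamma (real CARD('n) + p) / (2 * sqrt pi) * (norm z / h) powr e * exp (2 / h * norm z)"
    have nz: "norm z > 0" using z by simp
    have "hdot z z / complex_of_real h ^ 2 = of_real ((norm z / h)\<^sup>2)" by (simp add: zz power_divide)
    moreover have "((norm z / h)\<^sup>2) powr (1/2 * e) = (norm z / h) powr e"
    proof -
      have "(norm z / h)\<^sup>2 = (norm z / h) powr 2" using nz h by (subst powr_numeral) auto
      then show ?thesis by (simp only: powr_powr) simp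
    qed
    ultimately have pw: "(hdot z z / complex_of_real h ^ 2) powr complex_of_real (1/2 * e) = of_real ((norm z / h) powr e)"
      by (simp only: powr_of_real zero_le_power2)
    have ex: "exp (2 / complex_of_real h * of_real (norm z)) = of_real (exp (2 / h * norm z))"
      by (simp add: exp_of_real[symmetric])
    have "T_fun h p z z = of_real P * (1 - of_real (b / (4 * norm z) * h) + R h)"
      unfolding T[OF h] sq e_def[symmetric] b_def[symmetric] pw ex P_def by simp
    then have "Re (T_fun h p z z) = P * (1 - b / (4 * norm z) * h + Re (R h))" by simp
    moreover have "sphere_inner (\<lambda>x. K_kernel h p x z) (\<lambda>x. K_kernel h p x z) = T_fun h p z z"
      using sphere_inner_K_kernel[OF p h] T_fun_eq_hyp0F1[OF p h zz0] by simp
    ultimately show "(sphere_norm (\<lambda>x. K_kernel h p x z)) ^ 2 =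
           Gamma (real CARD('n) + p) / (2 * sqrt pi)
           * (norm z / h) powr (- p - real CARD('n) + 1/2)
           * exp (2 / h * norm z)
           * (1 - (real CARD('n) + p - 3/2) * (real CARD('n) + p - 1/2) / (4 * norm z) * h
                + Re (R h))"
      by (simp only: sphere_norm_square P_def e_def b_def)
  qed
qed

end
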